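(* In the Bayesian $k$-armed bandit problem described in the context, suppose the prior $\Gamma$ is $1$-regular with constants $0<c_0<C_0$, every $P_\mu$ is $1$-subgaussian, and $\mathcal{F}$ is uniformly upward-looking with parameters $(p_0,\delta_0)$. Then for any $k\ge\bigl(4e\log T\max(400,1/\delta_0^2)\bigr)/(c_0p_0)$, $$BR_{T,k}(\mathrm{Greedy})\le1+3T\Bigl[\frac{4e\log T}{kc_0p_0}\Bigr]^{1/2}+\frac{3C_0k}{2C_1}\bigl(10+\log(kc_0p_0/4e)-\log\log T\bigr),$$ where $C_1=(1-e^{-1})/2$. Furthermore, the Bayesian regret of SS-Greedy executed with $m=\Theta(T^{2/3})$ is $\tilde O(T^{2/3})$.
   Context: Bayesian $k$-armed bandit: horizon $T$, arms $[k]$, family $\mathcal{F}=\{P_\mu:\mu\in[0,1]\}$ with $P_\mu$ of mean $\mu$; prior $\Gamma$ on $[0,1]$ with density; means i.i.d. $\sim\Gamma$; pulling arm $i$ at time $t$ gives $Y_{it}\sim P_{\mu_i}$ independently, only the pulled reward observed. $R_T(\pi\mid\bm\mu)=T\max_i\mu_i-\sum_t\mathbb{E}[\mu_{a_t}\mid\pi]$, $BR_{T,k}(\pi)=\mathbb{E}[R_T(\pi\mid\bm\mu)]$. $1$-regular: $c_0\epsilon\le\mathbb{P}_\Gamma(\mu>1-\epsilon)\le\mathbb{P}_\Gamma(\mu\ge1-\epsilon)\le C_0\epsilon$ for $\epsilon\in(0,1]$. $1$-subgaussian: $\mathbb{E}[e^{s(Z-\mu)}]\le e^{s^2/2}$ for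 $Z\sim P_\mu$. A distribution $Q$ of mean $\mu$ with $Q-\mu$ $1$-subgaussian is upward-looking with parameter $p_0$ if, with $X_i$ i.i.d. $\sim Q$, $R_n(\theta)=\sum_{i\le n}X_i-n\theta$, $\tau(\theta)=\inf\{n\ge1:R_n(\theta)<0\text{ or }R_n(\theta)\ge1\}$, for every $\theta<\mu$ either $\mathbb{P}[R_{\tau(\theta)}(\theta)\ge1]\ge p_0$ or $\mathbb{E}[(X_1-\theta)\mathbf 1(X_1\ge\theta)]\ge p_0$. $\mathcal{F}$ is uniformly upward-looking with parameters $(p_0,\delta_0)$ if $P_\mu$ is upward-looking with parameter $p_0$ for every $\mu\ge1-\delta_0$. Greedy: pull each arm once, then always the arm with largest empirical mean. SS-Greedy($m$): run Greedy on $m$ arms drawn uniformly without replacement from $[k]$. $\tilde O$ hides polylog factors and constants. *)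

theory Defs
  imports "HOL-Probability.Probability" "HOL-Library.Landau_Symbols"
begin

definition has_mean :: "real measure \<Rightarrow> real \<Rightarrow> bool" where
  "has_mean Q \<mu> \<longleftrightarrow> integrable Q (\<lambda>x. x) \<and> (\<integral>x. x \<partial>Q) = \<mu>"

definition subgaussian1 :: "real measure \<Rightarrow> real \<Rightarrow> bool" where
  "subgaussian1 Q \<mu> \<longleftrightarrow>
     (\<forall>s::real. (\<integral>\<^sup>+x. ennreal (exp (s * (x - \<mu>))) \<partial>Q) \<le> ennreal (exp (s\<^sup>2 / 2)))"

definition walk :: "nat \<Rightarrow> real \<Rightarrow> (nat \<Rightarrow> real) \<Rightarrow> real" where
  "walk n \<theta> \<omega> = (\<Sum>i<n. \<omega> i) - real n * \<theta>"

text \<open>The event {tau(theta) < infinity and R_tau(theta) >= 1}, where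
  tau(theta) = inf{n >= 1 : R_n(theta) < 0 or R_n(theta) >= 1}.\<close>
definition exits_up :: "real \<Rightarrow> (nat \<Rightarrow> real) \<Rightarrow> bool" where
  "exits_up \<theta> \<omega> \<longleftrightarrow>
     (\<exists>n\<ge>1. walk n \<theta> \<omega> \<ge> 1 \<and>
        (\<forall>m. 1 \<le> m \<and> m < n \<longrightarrow> 0 \<le> walk m \<theta> \<omega> \<and> walk m \<theta> \<omega> < 1))"

definition upward_looking :: "real measure \<Rightarrow> real \<Rightarrow> real \<Rightarrow> bool" where
  "upward_looking Q \<mu> p0 \<longleftrightarrow>
     prob_space Q \<and> sets Q = sets borel \<and> has_mean Q \<mu> \<and> subgaussian1 Q \<mu> \<and>
     (\<forall>\<theta><\<mu>.
        measure (PiM UNIV (\<lambda>_::nat. Q)) {\<omega> \<in> space (PiM UNIV (\<lambda>_::nat. Q)). exits_up \<theta> \<omega>} \<ge> p0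
      \<or> (\<integral>x. (if x \<ge> \<theta> then x - \<theta> else 0) \<partial>Q) \<ge> p0)"

definition uniformly_upward_looking :: "(real \<Rightarrow> real measure) \<Rightarrow> real \<Rightarrow> real \<Rightarrow> bool" where
  "uniformly_upward_looking P p0 \<delta>0 \<longleftrightarrow>
     (\<forall>\<mu>. 1 - \<delta>0 \<le> \<mu> \<and> \<mu> \<le> 1 \<longrightarrow> upward_looking (P \<mu>) \<mu> p0)"

definition one_regular :: "real measure \<Rightarrow> real \<Rightarrow> real \<Rightarrow> bool" where
  "one_regular \<Gamma> c0 C0 \<longleftrightarrow>
     (\<forall>\<epsilon>. 0 < \<epsilon> \<and> \<epsilon> \<le> 1 \<longrightarrow>
        c0 * \<epsilon> \<le> measure \<Gamma> {1 - \<epsilon><..} \<and>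
        measure \<Gamma> {1 - \<epsilon><..} \<le> measure \<Gamma> {1 - \<epsilon>..} \<and>
        measure \<Gamma> {1 - \<epsilon>..} \<le> C0 * \<epsilon>)"

text \<open>Y i s is the reward of arm i if pulled at time s (times start at 0).
  A history h is the list of arms pulled at times 0, ..., length h - 1.\<close>
definition emp_mean :: "(nat \<Rightarrow> nat \<Rightarrow> real) \<Rightarrow> nat list \<Rightarrow> nat \<Rightarrow> real" where
  "emp_mean Y h i =
     (\<Sum>s\<in>{s. s < length h \<and> h ! s = i}. Y i s) / real (card {s. s < length h \<and> h ! s = i})"

definition greedy_next :: "nat list \<Rightarrow> (nat \<Rightarrow> nat \<Rightarrow> real) \<Rightarrow> nat list \<Rightarrow> nat" where
  "greedy_next as Y h =
     (if length h < length as then as ! length h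
      else as ! (LEAST j. j < length as \<and>
                   (\<forall>l<length as. emp_mean Y h (as ! l) \<le> emp_mean Y h (as ! j))))"

primrec greedy_hist :: "nat list \<Rightarrow> (nat \<Rightarrow> nat \<Rightarrow> real) \<Rightarrow> nat \<Rightarrow> nat list" where
  "greedy_hist as Y 0 = []"
| "greedy_hist as Y (Suc t) = greedy_hist as Y t @ [greedy_next as Y (greedy_hist as Y t)]"

definition greedy_policy :: "nat list \<Rightarrow> (nat \<Rightarrow> nat \<Rightarrow> real) \<Rightarrow> nat \<Rightarrow> nat" where
  "greedy_policy as Y t = greedy_next as Y (greedy_hist as Y t)"

definition prior_measure :: "real measure \<Rightarrow> nat \<Rightarrow> (nat \<Rightarrow> real) measure" where
  "prior_measure \<Gamma> k = PiM {..<k} (\<lambda>_. \<Gamma>)"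

definition reward_measure ::
    "(real \<Rightarrow> real measure) \<Rightarrow> nat \<Rightarrow> nat \<Rightarrow> (nat \<Rightarrow> real) \<Rightarrow> (nat \<times> nat \<Rightarrow> real) measure" where
  "reward_measure P k T \<mu> = PiM ({..<k} \<times> {..<T}) (\<lambda>(i, t). P (\<mu> i))"

text \<open>A (deterministic) policy maps the reward table and a time t to the arm pulled at t;
  it must only depend on rewards observed before t (true for Greedy).
  BR_{T,k}(pi) = E[ T max_i mu_i - sum_{t<T} mu_{a_t} ].\<close>
definition bayes_regret ::
    "real measure \<Rightarrow> (real \<Rightarrow> real measure) \<Rightarrow> nat \<Rightarrow> nat \<Rightarrow>
     ((nat \<Rightarrow> nat \<Rightarrow> real) \<Rightarrow> nat \<Rightarrow> nat) \<Rightarrow> ennreal" where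
  "bayes_regret \<Gamma> P k T pol =
     (\<integral>\<^sup>+\<mu>. (\<integral>\<^sup>+\<omega>. ennreal (real T * (MAX i\<in>{..<k}. \<mu> i) - (\<Sum>t<T. \<mu> (pol (curry \<omega>) t)))
               \<partial>reward_measure P k T \<mu>) \<partial>prior_measure \<Gamma> k)"

definition greedy_bayes_regret :: "real measure \<Rightarrow> (real \<Rightarrow> real measure) \<Rightarrow> nat \<Rightarrow> nat \<Rightarrow> ennreal" where
  "greedy_bayes_regret \<Gamma> P k T = bayes_regret \<Gamma> P k T (greedy_policy [0..<k])"

definition ss_greedy_bayes_regret ::
    "real measure \<Rightarrow> (real \<Rightarrow> real measure) \<Rightarrow> nat \<Rightarrow> nat \<Rightarrow> nat \<Rightarrow> ennreal" where
  "ss_greedy_bayes_regret \<Gamma> P k T m =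
     (\<integral>\<^sup>+S. bayes_regret \<Gamma> P k T (greedy_policy (sorted_list_of_set S))
        \<partial>measure_pmf (pmf_of_set {S. S \<subseteq> {..<k} \<and> card S = m}))"

end

theory Submission
  imports Defs "HOL-Real_Asymp.Real_Asymp"
begin

text \<open>
  Condition on the means \<open>\<mu>\<close>, put \<open>\<theta> = 1 - 2 * \<delta>\<close>, and follow for each arm the excess of its
  collected rewards over \<open>\<theta>\<close> per pull.  An arm with \<open>\<mu> \<ge> 1 - \<delta>\<close> is upward-looking, so its excess
  stays nonnegative forever with probability at least \<open>p0 * \<delta> / 2\<close>.  As long as one such arm
  survives, Greedy only pulls arms whose excess is nonnegative, and the
  expected number of such pulls of an arm with \<open>\<mu> < 1 - 3 * \<delta>\<close> is of order \<open>1 / (\<theta> - \<mu>)\<^sup>2\<close>.  Both estimates are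
  obtained from explicit supermartingales of the adaptively sampled reward table, so no
  reduction to independent reward stacks is needed.

  Averaging over the prior, no good arm survives with probability at most
  \<open>(1 - p0 * c0 * \<delta>\<^sup>2 / 2) ^ k\<close>, which is at most \<open>1 / T\<close> for \<open>\<delta>\<^sup>2 = 4 * e * ln T / (k * c0 * p0)\<close>, and
  the bad arms cost at most \<open>k * E[3 / (C1 * (\<theta> - \<mu>))]\<close>, which is of order \<open>k * ln (1 / \<delta>)\<close> by
  regularity.  Nothing changes if Greedy runs on a subset of the arms, because the regret is
  measured against the upper bound 1 of all means; this gives the result for SS-Greedy.
\<close>

subsection \<open>Walks that stay nonnegative\<close>

lemma one_minus_exp_ge:
  fixes x :: real
  assumes "0 \<le> x"
  shows "x - x\<^sup>2 / 2 \<le> 1 - exp (- x)"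
proof -
  \<comment> \<open>The product of 1 - x + x^2/2 with the quadratic Taylor polynomial of
    \<open>exp x\<close> is 1 + x^4/4, so its product with \<open>exp x\<close> is at least
    1.\<close>
  have "1 \<le> 1 + x ^ 4 / 4" by simp
  also have "\<dots> = (1 - x + x\<^sup>2 / 2) * (1 + x + x\<^sup>2 / 2)"
    by (simp add: algebra_simps power2_eq_square power4_eq_xxxx)
  also have "\<dots> \<le> (1 - x + x\<^sup>2 / 2) * exp x"
  proof (rule mult_left_mono)
    show "1 + x + x\<^sup>2 / 2 \<le> exp x"
      using exp_lower_Taylor_quadratic[OF assms] .
    have "0 \<le> (1 - x)\<^sup>2 + 1" by simp
    then show "0 \<le> 1 - x + x\<^sup>2 / 2"
      by (simp add: power2_eq_square algebra_simps)
  qed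
  finally show ?thesis
    by (simp add: exp_minus field_simps)
qed

text \<open>Redrawing coordinate \<open>j\<close> independently leaves a product law unchanged, so
  only the average of \<open>f\<close> over that coordinate matters. This does the work of
  conditioning on all other coordinates.\<close>

lemma nn_integral_PiM_resample_le:
  fixes f g :: "('i \<Rightarrow> 'a) \<Rightarrow> ennreal"
  assumes "finite I" "j \<in> I" and prob: "\<And>i. i \<in> I \<Longrightarrow> prob_space (M i)"
    and f: "f \<in> borel_measurable (PiM I M)" and g: "g \<in> borel_measurable (PiM I M)"
    and le: "\<And>w. w \<in> space (PiM I M) \<Longrightarrow> (\<integral>\<^sup>+y. f (w(j := y)) \<partial>M j) \<le> g w"
  shows "(\<integral>\<^sup>+w. f w \<partial>PiM I M) \<le> (\<integral>\<^sup>+w. g w \<partial>PiM I M)"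
proof -
  \<comment> \<open>Padding with one-point spaces outside \<open>I\<close> makes every factor a
    probability space, as \<open>product_prob_space\<close> demands of all indices.\<close>
  define N where "N i = (if i \<in> I then M i else count_space {undefined})" for i
  have "prob_space (count_space {undefined :: 'a})"
    by standard (simp add: emeasure_count_space)
  then have N: "prob_space (N i)" for i
    by (simp add: N_def prob)
  interpret product_prob_space N
    by (intro product_prob_spaceI N)
  have eq: "PiM I M = PiM (insert j (I - {j})) N"
    using \<open>j \<in> I\<close> by (intro PiM_cong) (auto simp: N_def)
  note fg = f[unfolded eq] g[unfolded eq]
  have le': "(\<integral>\<^sup>+y. f (w(j := y)) \<partial>N j) \<le> g w" if "w \<in> space (PiM (insert j (I - {j})) N)" for w
    using le[OF that[folded eq]] \<open>j \<in> I\<close> by (simp add: N_def)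
  \<comment> \<open>The idle integral over \<open>z\<close> has total mass 1. It supplies a full
    point \<open>x(j := z)\<close> at which \<open>le'\<close> applies; overwriting \<open>z\<close>
    by \<open>y\<close> gives back the integrand.\<close>
  have "(\<integral>\<^sup>+w. f w \<partial>PiM I M) = (\<integral>\<^sup>+x. \<integral>\<^sup>+z. \<integral>\<^sup>+y. f (x(j := y)) \<partial>N j \<partial>N j \<partial>PiM (I - {j}) N)"
    using \<open>finite I\<close> unfolding eq
    by (subst product_nn_integral_insert[OF _ _ fg(1)]) (auto simp: prob_space.emeasure_space_1[OF N])
  also have "\<dots> \<le> (\<integral>\<^sup>+x. \<integral>\<^sup>+z. g (x(j := z)) \<partial>N j \<partial>PiM (I - {j}) N)"
  proof (intro nn_integral_mono)
    fix x z assume "x \<in> space (PiM (I - {j}) N)" "z \<in> space (N j)"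
    then have "x(j := z) \<in> space (PiM (insert j (I - {j})) N)"
      by (auto simp: space_PiM PiE_def extensional_def Pi_def)
    from le'[OF this] show "(\<integral>\<^sup>+y. f (x(j := y)) \<partial>N j) \<le> g (x(j := z))" by simp
  qed
  also have "\<dots> = (\<integral>\<^sup>+w. g w \<partial>PiM I M)"
    using \<open>finite I\<close> unfolding eq
    by (subst product_nn_integral_insert[OF _ _ fg(2)]) auto
  finally show ?thesis .
qed

section \<open>Subgaussian moments and the ruin bound\<close>

lemma subgaussian1_mgf:
  assumes "prob_space Q" and [simp, measurable_cong]: "sets Q = sets borel" and "subgaussian1 Q \<mu>"
  shows "integrable Q (\<lambda>x. exp (s * (x - \<mu>)))"
    and "(\<integral>x. exp (s * (x - \<mu>)) \<partial>Q) \<le> exp (s\<^sup>2 / 2)"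
proof -
  have le: "(\<integral>\<^sup>+x. ennreal (exp (s * (x - \<mu>))) \<partial>Q) \<le> ennreal (exp (s\<^sup>2 / 2))"
    using assms(3) by (simp add: subgaussian1_def)
  show *: "integrable Q (\<lambda>x. exp (s * (x - \<mu>)))"
    by (rule integrableI_bounded) (use le in \<open>auto simp: top.not_eq_extremum[symmetric] top_unique\<close>)
  show "(\<integral>x. exp (s * (x - \<mu>)) \<partial>Q) \<le> exp (s\<^sup>2 / 2)"
    using le by (simp add: nn_integral_eq_integral[OF *])
qed

text \<open>For the exponent \<open>- 2 * (\<mu> - \<theta>)\<close> the exponential of the walk is a supermartingale, which makes \<open>1 - exp (- 2 * (\<mu> - \<theta>) * r)\<close> a lower bound on the probability
  that a walk with drift \<open>\<mu> - \<theta>\<close> started at \<open>r\<close> never becomes negative.\<close>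

definition ruin_bound :: "real \<Rightarrow> real \<Rightarrow> real" where
  "ruin_bound d r = max 0 (1 - exp (- 2 * d * r))"

lemma ruin_bound_measurable [measurable]: "ruin_bound d \<in> borel_measurable borel"
  unfolding ruin_bound_def by measurable

lemma ruin_bound_bounds: "0 \<le> ruin_bound d r" "ruin_bound d r \<le> 1"
  by (auto simp: ruin_bound_def)

lemma ruin_bound_neg: "0 < d \<Longrightarrow> r \<le> 0 \<Longrightarrow> ruin_bound d r = 0"
  by (auto simp: ruin_bound_def mult_nonneg_nonpos)

lemma ruin_bound_mono: "0 < d \<Longrightarrow> r \<le> r' \<Longrightarrow> ruin_bound d r \<le> ruin_bound d r'"
  using mult_left_mono[of r r' d] by (simp add: ruin_bound_def max.coboundedI2)

lemma ruin_bound_ge: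
  assumes "0 < d" "0 \<le> r"
  shows "d * min r (1 / (2 * d)) \<le> ruin_bound d r"
proof -
  \<comment> \<open>The cap \<open>1 / (2 * d)\<close> keeps \<open>x\<close> at most 1, where x -
    x^2/2 is at least x/2.\<close>
  define x where "x = 2 * d * min r (1 / (2 * d))"
  have x: "0 \<le> x" "x \<le> 1" "x \<le> 2 * d * r" using assms by (auto simp: x_def min_def field_simps)
  have "x / 2 \<le> x - x\<^sup>2 / 2"
    using x mult_left_mono[of x 1 x] by (simp add: power2_eq_square)
  also have "\<dots> \<le> 1 - exp (- x)" by (rule one_minus_exp_ge) fact
  also have "\<dots> \<le> ruin_bound d r" using x by (simp add: ruin_bound_def)
  finally show ?thesis by (simp add: x_def)
qed

lemma (in prob_space) integrable_in_unit:
  fixes f :: "'a \<Rightarrow> real"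
  assumes "f \<in> borel_measurable M" "\<And>x. 0 \<le> f x" "\<And>x. f x \<le> 1"
  shows "integrable M f"
  by (rule integrable_const_bound[where B = 1]) (use assms in auto)

text \<open>The exponent is chosen so that the drift factor \<open>exp (- 2 * d\<^sup>2)\<close>
  cancels the subgaussian bound \<open>exp (2 * d\<^sup>2)\<close>. Hence 1 minus the exponential
  does not decrease on average. Cutting off at 0 preserves this, since it only raises the average
  and makes it nonnegative.\<close>

lemma ruin_bound_le_integral:
  assumes "prob_space Q" and sets[simp, measurable_cong]: "sets Q = sets borel" and "subgaussian1 Q \<mu>"
    and "\<theta> < \<mu>" and "0 \<le> r"
  shows "ruin_bound (\<mu> - \<theta>) r \<le> (\<integral>x. ruin_bound (\<mu> - \<theta>) (r + (x - \<theta>)) \<partial>Q)"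
proof -
  interpret prob_space Q by fact
  define d where "d = \<mu> - \<theta>"
  have d: "0 < d" using assms by (simp add: d_def)
  note mgf = subgaussian1_mgf[OF assms(1-3), of "- 2 * d"]
  have split: "exp (- 2 * d * (r + (x - \<theta>))) = exp (- 2 * d * r - 2 * d\<^sup>2) * exp (- 2 * d * (x - \<mu>))" for x
    unfolding exp_add[symmetric] by (rule arg_cong[where f = exp]) (simp add: d_def algebra_simps power2_eq_square)
  have int: "integrable Q (\<lambda>x. exp (- 2 * d * (r + (x - \<theta>))))"
    unfolding split using mgf(1) by (intro integrable_mult_right)
  have "(\<integral>x. exp (- 2 * d * (r + (x - \<theta>))) \<partial>Q) \<le> exp (- 2 * d * r - 2 * d\<^sup>2) * exp ((- 2 * d)\<^sup>2 / 2)"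
    unfolding split using mgf(2) by (simp del: exp_le_cancel_iff)
  also have "\<dots> = exp (- 2 * d * r)"
    unfolding exp_add[symmetric] by (simp add: power2_eq_square)
  finally have "1 - exp (- 2 * d * r) \<le> 1 - (\<integral>x. exp (- 2 * d * (r + (x - \<theta>))) \<partial>Q)" by simp
  also have "\<dots> = (\<integral>x. 1 - exp (- 2 * d * (r + (x - \<theta>))) \<partial>Q)"
    using int by (simp add: prob_space)
  also have "\<dots> \<le> (\<integral>x. ruin_bound d (r + (x - \<theta>)) \<partial>Q)"
    by (rule integral_mono) (use int in \<open>auto intro!: integrable_in_unit ruin_bound_bounds, auto simp: ruin_bound_def\<close>)
  finally have "1 - exp (- 2 * d * r) \<le> (\<integral>x. ruin_bound d (r + (x - \<theta>)) \<partial>Q)" .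
  moreover have "0 \<le> (\<integral>x. ruin_bound d (r + (x - \<theta>)) \<partial>Q)"
    by (rule Bochner_Integration.integral_nonneg) (simp add: ruin_bound_bounds)
  ultimately show ?thesis
    by (simp add: ruin_bound_def[of _ r] d_def)
qed

section \<open>Reaching level 1 before becoming negative\<close>

definition reaches_one :: "real \<Rightarrow> real \<Rightarrow> (nat \<Rightarrow> real) \<Rightarrow> bool" where
  "reaches_one \<theta> r w \<longleftrightarrow>
     (\<exists>n. r + walk n \<theta> w \<ge> 1 \<and> (\<forall>m<n. 0 \<le> r + walk m \<theta> w \<and> r + walk m \<theta> w < 1))"

lemma walk_0 [simp]: "walk 0 \<theta> w = 0"
  by (simp add: walk_def)

lemma walk_case_nat: "walk (Suc n) \<theta> (case_nat x w) = (x - \<theta>) + walk n \<theta> w"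
  unfolding walk_def by (subst sum.lessThan_Suc_shift) (simp add: algebra_simps)

text \<open>\<open>reaches_one\<close> admits any start \<open>r\<close> and also checks time 0,
  which suits the one-step recursion below. From start 0 the walk is neither negative nor at 1 at
  time 0, so the extra check changes nothing.\<close>

lemma exits_up_iff: "exits_up \<theta> w \<longleftrightarrow> reaches_one \<theta> 0 w"
proof
  assume "exits_up \<theta> w"
  then obtain n where "walk n \<theta> w \<ge> 1" "\<forall>m. 1 \<le> m \<and> m < n \<longrightarrow> 0 \<le> walk m \<theta> w \<and> walk m \<theta> w < 1"
    unfolding exits_up_def by blast
  moreover from this(2) have "\<forall>m<n. 0 \<le> walk m \<theta> w \<and> walk m \<theta> w < 1"
    by (metis less_one not_le walk_0 order_refl zero_less_one)
  ultimately show "reaches_one \<theta> 0 w" by (auto simp: reaches_one_def)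
next
  assume "reaches_one \<theta> 0 w"
  then obtain n where n: "walk n \<theta> w \<ge> 1" "\<forall>m<n. 0 \<le> walk m \<theta> w \<and> walk m \<theta> w < 1"
    by (auto simp: reaches_one_def)
  then have "n \<ge> 1" by (cases n) auto
  with n show "exits_up \<theta> w" by (auto simp: exits_up_def)
qed

lemma reaches_one_neg:
  assumes "r < 0" shows "\<not> reaches_one \<theta> r w"
proof
  assume "reaches_one \<theta> r w"
  then obtain n where "r + walk n \<theta> w \<ge> 1" "\<forall>m<n. 0 \<le> r + walk m \<theta> w"
    by (auto simp: reaches_one_def)
  with assms show False by (cases n) (auto dest: spec[of _ 0])
qed

lemma reaches_one_case_nat:
  assumes "0 \<le> r" "r < 1"
  shows "reaches_one \<theta> r (case_nat x w) \<longleftrightarrow> reaches_one \<theta> (r + (x - \<theta>)) w"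
proof
  assume "reaches_one \<theta> r (case_nat x w)"
  then obtain n where n: "r + walk n \<theta> (case_nat x w) \<ge> 1"
      "\<forall>m<n. 0 \<le> r + walk m \<theta> (case_nat x w) \<and> r + walk m \<theta> (case_nat x w) < 1"
    by (auto simp: reaches_one_def)
  from n(1) assms obtain n' where n': "n = Suc n'" by (cases n) auto
  have "r + (x - \<theta>) + walk n' \<theta> w \<ge> 1"
    using n(1) by (simp add: n' walk_case_nat add.assoc)
  moreover have "0 \<le> r + (x - \<theta>) + walk m \<theta> w \<and> r + (x - \<theta>) + walk m \<theta> w < 1" if "m < n'" for m
    using n(2)[rule_format, of "Suc m"] that by (simp add: n' walk_case_nat add.assoc)
  ultimately show "reaches_one \<theta> (r + (x - \<theta>)) w"
    by (auto simp: reaches_one_def)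
next
  assume "reaches_one \<theta> (r + (x - \<theta>)) w"
  then obtain n where n: "r + (x - \<theta>) + walk n \<theta> w \<ge> 1"
      "\<forall>m<n. 0 \<le> r + (x - \<theta>) + walk m \<theta> w \<and> r + (x - \<theta>) + walk m \<theta> w < 1"
    by (auto simp: reaches_one_def)
  have "0 \<le> r + walk m \<theta> (case_nat x w) \<and> r + walk m \<theta> (case_nat x w) < 1" if "m < Suc n" for m
    using n(2) that assms by (cases m) (auto simp: walk_case_nat add.assoc)
  moreover have "r + walk (Suc n) \<theta> (case_nat x w) \<ge> 1"
    using n(1) by (simp add: walk_case_nat add.assoc)
  ultimately show "reaches_one \<theta> r (case_nat x w)"
    unfolding reaches_one_def by blast
qed

lemma reaches_one_measurable [measurable]:
  assumes [measurable_cong]: "sets Q = sets borel"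
  shows "Measurable.pred (borel \<Otimes>\<^sub>M PiM UNIV (\<lambda>_::nat. Q)) (\<lambda>(r, w). reaches_one \<theta> r w)"
  unfolding reaches_one_def walk_def split_beta by measurable

definition reach_prob :: "real measure \<Rightarrow> real \<Rightarrow> real \<Rightarrow> real" where
  "reach_prob Q \<theta> r =
     measure (PiM UNIV (\<lambda>_::nat. Q)) {w \<in> space (PiM UNIV (\<lambda>_::nat. Q)). reaches_one \<theta> r w}"

context
  fixes Q :: "real measure"
  assumes prob: "prob_space Q" and sets[simp, measurable_cong]: "sets Q = sets borel"
begin

interpretation Q: prob_space Q by (rule prob)
interpretation seq: sequence_space Q ..

lemma reach_set_measurable [measurable]:
  "{w \<in> space (PiM UNIV (\<lambda>_::nat. Q)). reaches_one \<theta> r w} \<in> sets (PiM UNIV (\<lambda>_::nat. Q))"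
  using measurable_compose[OF measurable_Pair1' reaches_one_measurable[OF sets, of \<theta>], of r]
  by (simp add: pred_def)

lemma ennreal_reach_prob:
  "ennreal (reach_prob Q \<theta> r) = (\<integral>\<^sup>+w. indicator {w. reaches_one \<theta> r w} w \<partial>PiM UNIV (\<lambda>_::nat. Q))"
proof -
  have "ennreal (reach_prob Q \<theta> r) =
      (\<integral>\<^sup>+w. indicator {w \<in> space (PiM UNIV (\<lambda>_::nat. Q)). reaches_one \<theta> r w} w \<partial>PiM UNIV (\<lambda>_::nat. Q))"
    by (simp add: reach_prob_def seq.emeasure_eq_measure[symmetric])
  also have "\<dots> = (\<integral>\<^sup>+w. indicator {w. reaches_one \<theta> r w} w \<partial>PiM UNIV (\<lambda>_::nat. Q))"
    by (rule nn_integral_cong) (auto simp: indicator_def)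
  finally show ?thesis .
qed

lemma reach_prob_bounds: "0 \<le> reach_prob Q \<theta> r" "reach_prob Q \<theta> r \<le> 1"
  by (auto simp: reach_prob_def)

lemma reach_prob_measurable [measurable]: "reach_prob Q \<theta> \<in> borel_measurable borel"
proof -
  have "(\<lambda>r. ennreal (reach_prob Q \<theta> r)) \<in> borel_measurable borel"
    unfolding ennreal_reach_prob
    by (rule seq.borel_measurable_nn_integral)
       (use reaches_one_measurable[OF sets, of \<theta>] in \<open>auto simp: indicator_def case_prod_beta\<close>)
  then have "(\<lambda>r. enn2real (ennreal (reach_prob Q \<theta> r))) \<in> borel_measurable borel" by measurable
  then show ?thesis by (simp add: reach_prob_bounds)
qed

lemma reach_prob_neg: "r < 0 \<Longrightarrow> reach_prob Q \<theta> r = 0"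
  by (simp add: reach_prob_def reaches_one_neg)

text \<open>An i.i.d. sequence is an independent first value prepended to another such sequence.
  Integrating over the first value gives a harmonic equation while the walk is between 0 and
  1.\<close>

lemma reach_prob_step:
  assumes "0 \<le> r" "r < 1"
  shows "reach_prob Q \<theta> r = (\<integral>x. reach_prob Q \<theta> (r + (x - \<theta>)) \<partial>Q)"
proof -
  let ?S = "PiM UNIV (\<lambda>_::nat. Q)"
  have ind[measurable]: "(\<lambda>w. indicator {w. reaches_one \<theta> r w} w :: ennreal) \<in> borel_measurable ?S" for r
    using reach_set_measurable[of \<theta> r] unfolding pred_def[symmetric] by (simp add: indicator_def)
  have "ennreal (reach_prob Q \<theta> r) =
      (\<integral>\<^sup>+w. indicator {w. reaches_one \<theta> r w} w \<partial>distr (Q \<Otimes>\<^sub>M ?S) ?S (\<lambda>(s, w). case_nat s w))"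
    by (simp add: seq.PiM_iter ennreal_reach_prob)
  also have "\<dots> = (\<integral>\<^sup>+p. indicator {w. reaches_one \<theta> r w} ((\<lambda>(s, w). case_nat s w) p) \<partial>(Q \<Otimes>\<^sub>M ?S))"
    by (rule nn_integral_distr) measurable
  also have "\<dots> = (\<integral>\<^sup>+x. \<integral>\<^sup>+w. indicator {w. reaches_one \<theta> r w} (case_nat x w) \<partial>?S \<partial>Q)"
    by (subst seq.nn_integral_fst[symmetric]) simp_all
  also have "\<dots> = (\<integral>\<^sup>+x. ennreal (reach_prob Q \<theta> (r + (x - \<theta>))) \<partial>Q)"
    unfolding ennreal_reach_prob
    by (intro nn_integral_cong) (simp add: indicator_def reaches_one_case_nat[OF assms])
  also have "\<dots> = ennreal (\<integral>x. reach_prob Q \<theta> (r + (x - \<theta>)) \<partial>Q)"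
    by (intro nn_integral_eq_integral Q.integrable_in_unit) (auto simp: reach_prob_bounds)
  finally show ?thesis
    by (simp add: reach_prob_bounds)
qed

end


section \<open>Minorants of the survival probability\<close>

lemma truncated_excess_bound:
  assumes "prob_space Q" and sets[simp, measurable_cong]: "sets Q = sets borel"
    and mean: "has_mean Q \<mu>" and sub: "subgaussian1 Q \<mu>"
    and "\<theta> < \<mu>" "\<mu> - \<theta> \<le> 1 / 10"
  shows "(\<mu> - \<theta>) / 2 * (\<integral>x. (if x \<ge> \<theta> then x - \<theta> else 0) \<partial>Q)
           \<le> (\<integral>x. ruin_bound (\<mu> - \<theta>) (x - \<theta>) \<partial>Q)"
proof -
  interpret prob_space Q by fact
  define d where "d = \<mu> - \<theta>"
  \<comment> \<open>\<open>ruin_bound d\<close> is controlled linearly only up to \<open>M\<close>,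
    so the excess above \<theta> is truncated there. The truncation loses at most
    \<open>d / 2\<close>, hence at most half of the mean of \<open>pos\<close>; this is the factor
    1/2 in the claim.\<close>
  define M where "M = 1 / (2 * d)"
  have d: "0 < d" "d \<le> 1 / 10" using assms by (auto simp: d_def)
  have M: "5 \<le> M" and Md: "M * d = 1 / 2" using d by (auto simp: M_def field_simps)
  define pos where "pos x = (if x \<ge> \<theta> then x - \<theta> else 0)" for x
  \<comment> \<open>\<open>tail\<close> dominates the overshoot x - \<theta> - M because
    \<open>exp y\<close> exceeds \<open>y\<close>. It is written around \<mu> so that the
    subgaussian bound with exponent \<open>M\<close> applies.\<close>
  define tail where "tail x = exp (M * (x - \<mu>)) * exp (1 / 2 - M\<^sup>2) / M" for x
  have tail_eq: "tail x = exp (M * (x - \<theta> - M)) / M" for x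
    unfolding tail_def exp_add[symmetric] using Md by (simp add: d_def algebra_simps power2_eq_square)
  have int_x: "integrable Q (\<lambda>x. x)" and mean': "(\<integral>x. x \<partial>Q) = \<mu>"
    using mean by (auto simp: has_mean_def)
  have int_pos: "integrable Q pos"
  proof (rule Bochner_Integration.integrable_bound)
    show "integrable Q (\<lambda>x. x - \<theta>)" using int_x by simp
    show "pos \<in> borel_measurable Q" unfolding pos_def by measurable
  qed (auto simp: pos_def)
  note mgf = subgaussian1_mgf[OF assms(1,2) sub, of M]
  have int_tail: "integrable Q tail"
    unfolding tail_def using mgf(1) by simp
  have "(\<integral>x. tail x \<partial>Q) \<le> exp (M\<^sup>2 / 2) * exp (1 / 2 - M\<^sup>2) / M"
    unfolding tail_def using mgf(2) M by (simp add: divide_right_mono)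
  also have "exp (M\<^sup>2 / 2) * exp (1 / 2 - M\<^sup>2) = exp (1 / 2 - M\<^sup>2 / 2)"
    unfolding exp_add[symmetric] by (simp add: field_simps)
  also have "\<dots> \<le> 1 / 4"
  proof -
    have "25 \<le> M\<^sup>2" using power_mono[OF M, of 2] by simp
    then have "exp (1 / 2 - M\<^sup>2 / 2) \<le> exp (- 12)" by simp
    also have "\<dots> \<le> (1 :: real) / 4"
      using exp_ge_add_one_self[of "12 :: real"] by (simp add: exp_minus field_simps)
    finally show ?thesis .
  qed
  finally have tail: "(\<integral>x. tail x \<partial>Q) \<le> d / 2"
    using M d by (simp add: M_def divide_right_mono)
  have pos_ge: "d \<le> (\<integral>x. pos x \<partial>Q)"
  proof -
    have "d = (\<integral>x. x - \<theta> \<partial>Q)" using int_x mean' by (simp add: d_def prob_space)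
    also have "\<dots> \<le> (\<integral>x. pos x \<partial>Q)"
    proof (rule integral_mono)
      show "integrable Q (\<lambda>x. x - \<theta>)" using int_x by simp
    qed (rule int_pos, simp add: pos_def)
    finally show ?thesis .
  qed
  have pointwise: "d * (pos x - tail x) \<le> ruin_bound d (x - \<theta>)" for x
  proof (cases "x \<ge> \<theta>")
    case True
    have "x - \<theta> - M \<le> tail x"
    proof -
      have "M * (x - \<theta> - M) \<le> exp (M * (x - \<theta> - M))"
        using exp_ge_add_one_self[of "M * (x - \<theta> - M)"] by linarith
      then show ?thesis using M by (simp add: tail_eq field_simps)
    qed
    moreover have "0 \<le> tail x" using M by (simp add: tail_def)
    ultimately have "pos x - tail x \<le> min (x - \<theta>) M" using True by (simp add: pos_def)
    then have "d * (pos x - tail x) \<le> d * min (x - \<theta>) M" using d by (intro mult_left_mono) auto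
    also have "\<dots> \<le> ruin_bound d (x - \<theta>)"
      unfolding M_def using d True by (intro ruin_bound_ge) auto
    finally show ?thesis .
  next
    case False
    have "0 \<le> tail x" using M by (simp add: tail_def)
    then have "d * (pos x - tail x) \<le> 0" using False d by (simp add: pos_def)
    then show ?thesis using ruin_bound_bounds(1)[of d "x - \<theta>"] by linarith
  qed
  have "d / 2 * (\<integral>x. pos x \<partial>Q) \<le> d * ((\<integral>x. pos x \<partial>Q) - (\<integral>x. tail x \<partial>Q))"
    using pos_ge tail d by (simp add: field_simps)
  also have "\<dots> = (\<integral>x. d * (pos x - tail x) \<partial>Q)"
    using int_pos int_tail by simp
  also have "\<dots> \<le> (\<integral>x. ruin_bound d (x - \<theta>) \<partial>Q)"
    by (rule integral_mono)
       (use int_pos int_tail pointwise in \<open>auto intro!: integrable_in_unit ruin_bound_bounds\<close>)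
  finally show ?thesis by (simp add: d_def pos_def)
qed

text \<open>Such a function \<open>\<sigma>\<close> minorises the probability that a walk with increments \<open>x - \<theta>\<close>,
  \<open>x\<close> distributed as \<open>Q\<close>, never becomes negative.\<close>

definition survival_minorant :: "real measure \<Rightarrow> real \<Rightarrow> (real \<Rightarrow> real) \<Rightarrow> bool" where
  "survival_minorant Q \<theta> \<sigma> \<longleftrightarrow>
     \<sigma> \<in> borel_measurable borel \<and> (\<forall>r. 0 \<le> \<sigma> r \<and> \<sigma> r \<le> 1) \<and> (\<forall>r<0. \<sigma> r = 0) \<and>
     (\<forall>r\<ge>0. \<sigma> r \<le> (\<integral>x. \<sigma> (r + (x - \<theta>)) \<partial>Q))"

text \<open>The walk may first reach 1 and then survive from there. The recursion for
  \<open>reach_prob\<close> is available only below 1; from 1 on, \<open>ruin_bound\<close> is at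
  least as large as the product and carries the inequality, which is why the maximum is
  taken.\<close>

lemma survival_minorant_exits_up:
  assumes "prob_space Q" and sets[simp, measurable_cong]: "sets Q = sets borel"
    and "subgaussian1 Q \<mu>" "\<theta> < \<mu>"
  shows "survival_minorant Q \<theta>
    (\<lambda>r. max (ruin_bound (\<mu> - \<theta>) r) (ruin_bound (\<mu> - \<theta>) 1 * reach_prob Q \<theta> r))"
    (is "survival_minorant Q \<theta> ?\<sigma>")
proof -
  interpret prob_space Q by fact
  note [measurable] = reach_prob_measurable[OF assms(1,2)]
  note rb = reach_prob_bounds[OF assms(1,2)]
  define d where "d = \<mu> - \<theta>"
  have d: "0 < d" using assms by (simp add: d_def)
  let ?b = "ruin_bound d"
  have bounds: "0 \<le> ?\<sigma> r" "?\<sigma> r \<le> 1" for r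
    by (auto simp: ruin_bound_bounds le_max_iff_disj rb intro: mult_le_one)
  have int: "integrable Q (\<lambda>x. ?\<sigma> (r + (x - \<theta>)))" "integrable Q (\<lambda>x. ?b (r + (x - \<theta>)))"
    "integrable Q (\<lambda>x. reach_prob Q \<theta> (r + (x - \<theta>)))" for r
    using bounds rb by (auto intro!: integrable_in_unit ruin_bound_bounds)
  have step: "?\<sigma> r \<le> (\<integral>x. ?\<sigma> (r + (x - \<theta>)) \<partial>Q)" if r: "0 \<le> r" for r
  proof -
    have "?b r \<le> (\<integral>x. ?b (r + (x - \<theta>)) \<partial>Q)"
      unfolding d_def by (rule ruin_bound_le_integral) (use assms r in auto)
    also have "\<dots> \<le> (\<integral>x. ?\<sigma> (r + (x - \<theta>)) \<partial>Q)"
      by (rule integral_mono) (use int in \<open>auto simp: d_def\<close>)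
    finally have 1: "?b r \<le> (\<integral>x. ?\<sigma> (r + (x - \<theta>)) \<partial>Q)" .
    have 2: "?b 1 * reach_prob Q \<theta> r \<le> (\<integral>x. ?\<sigma> (r + (x - \<theta>)) \<partial>Q)"
    proof (cases "r < 1")
      case True
      have "?b 1 * reach_prob Q \<theta> r = (\<integral>x. ?b 1 * reach_prob Q \<theta> (r + (x - \<theta>)) \<partial>Q)"
        using r True by (simp add: reach_prob_step[OF assms(1,2) r True])
      also have "\<dots> \<le> (\<integral>x. ?\<sigma> (r + (x - \<theta>)) \<partial>Q)"
        by (rule integral_mono) (use int in \<open>auto simp: d_def\<close>)
      finally show ?thesis .
    next
      case False
      have "?b 1 * reach_prob Q \<theta> r \<le> ?b 1 * 1"
        by (intro mult_left_mono rb ruin_bound_bounds)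
      also have "\<dots> \<le> ?b r" using False d by (simp add: ruin_bound_mono)
      finally show ?thesis using 1 by linarith
    qed
    show ?thesis using 1 2 by (simp add: d_def)
  qed
  have neg: "?\<sigma> r = 0" if "r < 0" for r
    using that d by (simp add: ruin_bound_neg reach_prob_neg[OF assms(1,2)] d_def)
  show ?thesis
    unfolding survival_minorant_def using bounds step neg by (auto; measurable)
qed

text \<open>At 0 the function \<open>ruin_bound\<close> vanishes, but its average after one step is
  positive. As \<open>ruin_bound\<close> lies below this average, averaging the new function gives
  at least the average of \<open>ruin_bound\<close>, which is the new function itself.\<close>

lemma survival_minorant_first_step:
  assumes "prob_space Q" and sets[simp, measurable_cong]: "sets Q = sets borel"
    and "subgaussian1 Q \<mu>" "\<theta> < \<mu>"
  shows "survival_minorant Q \<theta>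
    (\<lambda>r. if r < 0 then 0 else (\<integral>x. ruin_bound (\<mu> - \<theta>) (r + (x - \<theta>)) \<partial>Q))"
    (is "survival_minorant Q \<theta> ?\<sigma>")
proof -
  interpret prob_space Q by fact
  define d where "d = \<mu> - \<theta>"
  have d: "0 < d" using assms by (simp add: d_def)
  have meas: "?\<sigma> \<in> borel_measurable borel" by measurable
  note [measurable] = meas
  have int: "integrable Q (\<lambda>x. ruin_bound (\<mu> - \<theta>) (r + (x - \<theta>)))" for r
    by (rule integrable_in_unit) (auto intro: ruin_bound_bounds)
  have le1: "(\<integral>x. ruin_bound (\<mu> - \<theta>) (r + (x - \<theta>)) \<partial>Q) \<le> 1" for r
    by (rule integral_le_const) (auto intro: int ruin_bound_bounds)
  have bounds: "0 \<le> ?\<sigma> r" "?\<sigma> r \<le> 1" for r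
    using le1[of r] by (auto simp: ruin_bound_bounds intro!: Bochner_Integration.integral_nonneg)
  have above: "ruin_bound (\<mu> - \<theta>) r \<le> ?\<sigma> r" for r
    using ruin_bound_le_integral[OF assms, of r] d by (auto simp: d_def ruin_bound_neg)
  have step: "?\<sigma> r \<le> (\<integral>x. ?\<sigma> (r + (x - \<theta>)) \<partial>Q)" if "0 \<le> r" for r
  proof -
    have "?\<sigma> r = (\<integral>x. ruin_bound (\<mu> - \<theta>) (r + (x - \<theta>)) \<partial>Q)" using that by simp
    also have "\<dots> \<le> (\<integral>x. ?\<sigma> (r + (x - \<theta>)) \<partial>Q)"
    proof (rule integral_mono)
      show "integrable Q (\<lambda>x. ?\<sigma> (r + (x - \<theta>)))"
        by (rule integrable_in_unit) (use bounds measurable_compose[OF _ meas] in auto)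
    qed (use int above in auto)
    finally show ?thesis .
  qed
  show ?thesis
    unfolding survival_minorant_def using meas bounds step by auto
qed

text \<open>Each alternative of the upward-looking property feeds one of the two minorants. A drift
  \<open>d\<close> of at most 1/10 puts \<open>1 / (2 * d)\<close> above 1, so
  \<open>ruin_bound d 1\<close> is at least \<open>d\<close> in the first case; in the second it
  makes the truncation harmless.\<close>

lemma upward_looking_survival_minorant:
  assumes up: "upward_looking Q \<mu> p0" and "0 \<le> p0" "\<theta> < \<mu>" "\<mu> - \<theta> \<le> 1 / 10"
  shows "\<exists>\<sigma>. survival_minorant Q \<theta> \<sigma> \<and> p0 * (\<mu> - \<theta>) / 2 \<le> \<sigma> 0"
proof -
  have Q: "prob_space Q" "sets Q = sets borel" "has_mean Q \<mu>" "subgaussian1 Q \<mu>"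
    using up by (auto simp: upward_looking_def)
  define d where "d = \<mu> - \<theta>"
  have d: "0 < d" "d \<le> 1 / 10" using assms by (auto simp: d_def)
  have "p0 \<le> reach_prob Q \<theta> 0 \<or> p0 \<le> (\<integral>x. (if x \<ge> \<theta> then x - \<theta> else 0) \<partial>Q)"
    using up \<open>\<theta> < \<mu>\<close> by (simp add: upward_looking_def exits_up_iff reach_prob_def)
  then show ?thesis
  proof
    assume p0: "p0 \<le> reach_prob Q \<theta> 0"
    have "d * min 1 (1 / (2 * d)) \<le> ruin_bound d 1"
      by (rule ruin_bound_ge) (use d in auto)
    then have "d \<le> ruin_bound d 1" using d by (simp add: min_def field_simps split: if_splits)
    then have "d * p0 \<le> ruin_bound d 1 * reach_prob Q \<theta> 0"
      using p0 d \<open>0 \<le> p0\<close> by (intro mult_mono) (auto simp: ruin_bound_bounds)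
    moreover have "0 \<le> d * p0" using d \<open>0 \<le> p0\<close> by simp
    ultimately have "p0 * d / 2 \<le> max (ruin_bound d 0) (ruin_bound d 1 * reach_prob Q \<theta> 0)"
      by (simp add: mult.commute le_max_iff_disj)
    then show ?thesis
      using survival_minorant_exits_up[OF Q(1,2,4) \<open>\<theta> < \<mu>\<close>] unfolding d_def by blast
  next
    assume p0: "p0 \<le> (\<integral>x. (if x \<ge> \<theta> then x - \<theta> else 0) \<partial>Q)"
    have "p0 * d / 2 = d / 2 * p0" by simp
    also have "\<dots> \<le> d / 2 * (\<integral>x. (if x \<ge> \<theta> then x - \<theta> else 0) \<partial>Q)"
      using p0 d by (intro mult_left_mono) auto
    also have "\<dots> \<le> (\<integral>x. ruin_bound d (x - \<theta>) \<partial>Q)"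
      unfolding d_def by (rule truncated_excess_bound) (use Q assms in auto)
    finally have "p0 * d / 2 \<le> (if (0::real) < 0 then 0 else (\<integral>x. ruin_bound d (0 + (x - \<theta>)) \<partial>Q))"
      by simp
    then show ?thesis
      using survival_minorant_first_step[OF Q(1,2,4) \<open>\<theta> < \<mu>\<close>] unfolding d_def by blast
  qed
qed

subsection \<open>Greedy with fixed means\<close>

lemma greedy_hist_length [simp]: "length (greedy_hist as Y t) = t"
  by (induction t) auto

lemma greedy_hist_nth: "s < t \<Longrightarrow> greedy_hist as Y t ! s = greedy_policy as Y s"
  by (induction t) (auto simp: nth_append greedy_policy_def less_Suc_eq)

lemma greedy_next_cong:
  assumes "\<And>i s. s < length h \<Longrightarrow> Y i s = Y' i s"
  shows "greedy_next as Y h = greedy_next as Y' h"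
proof -
  have "emp_mean Y h = emp_mean Y' h"
    unfolding emp_mean_def by (intro ext arg_cong2[where f = "(/)"] sum.cong) (auto simp: assms)
  then show ?thesis by (simp add: greedy_next_def)
qed

lemma greedy_hist_cong:
  assumes "\<And>i s. s < t \<Longrightarrow> Y i s = Y' i s"
  shows "greedy_hist as Y t = greedy_hist as Y' t"
  using assms
proof (induction t)
  case (Suc t)
  then have "greedy_hist as Y t = greedy_hist as Y' t" by simp
  then show ?case
    using Suc.prems by (auto intro!: greedy_next_cong)
qed simp

text \<open>Empirical means read only rewards already in the history, so Greedy is nonanticipating:
  the reward at time \<open>t\<close> can be redrawn without changing which arm is pulled
  then.\<close>

lemma greedy_policy_cong:
  assumes "\<And>i s. s < t \<Longrightarrow> Y i s = Y' i s"
  shows "greedy_policy as Y t = greedy_policy as Y' t"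
  unfolding greedy_policy_def
  by (subst greedy_hist_cong[of t Y Y']) (auto intro!: greedy_next_cong assms)

lemma greedy_next_argmax:
  assumes "as \<noteq> []" "length as \<le> length h"
  shows "greedy_next as Y h \<in> set as"
    and "i \<in> set as \<Longrightarrow> emp_mean Y h i \<le> emp_mean Y h (greedy_next as Y h)"
proof -
  define best where
    "best j \<longleftrightarrow> j < length as \<and> (\<forall>l<length as. emp_mean Y h (as ! l) \<le> emp_mean Y h (as ! j))" for j
  have "finite (emp_mean Y h ` set as)" "emp_mean Y h ` set as \<noteq> {}" using assms by auto
  from Max_in[OF this] obtain j where j: "j < length as" "emp_mean Y h (as ! j) = Max (emp_mean Y h ` set as)"
    by (metis (no_types, lifting) imageE in_set_conv_nth)
  then have "best j" by (auto simp: best_def)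
  then have best: "best (LEAST j. best j)" by (rule LeastI)
  have eq: "greedy_next as Y h = as ! (LEAST j. best j)"
    using assms by (simp add: greedy_next_def best_def)
  show "greedy_next as Y h \<in> set as"
    using best by (simp add: eq best_def)
  show "emp_mean Y h i \<le> emp_mean Y h (greedy_next as Y h)" if "i \<in> set as"
    using that best by (auto simp: eq best_def in_set_conv_nth)
qed

lemma greedy_policy_initial: "t < length as \<Longrightarrow> greedy_policy as Y t = as ! t"
  by (simp add: greedy_policy_def greedy_next_def)

lemma greedy_policy_in_set:
  assumes "as \<noteq> []"
  shows "greedy_policy as Y t \<in> set as"
proof (cases "t < length as")
  case False
  then show ?thesis
    unfolding greedy_policy_def using assms by (intro greedy_next_argmax) auto
qed (simp add: greedy_policy_initial)

text \<open>Off \<open>I\<close> every point of the product space has the constant value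
  \<open>undefined\<close>, so measurability needs no check of the index.\<close>

lemma borel_measurable_PiM_component:
  fixes M :: "'i \<Rightarrow> 'a :: topological_space measure"
  assumes "\<And>i. i \<in> I \<Longrightarrow> sets (M i) = sets borel"
  shows "(\<lambda>w. w i) \<in> borel_measurable (PiM I M)"
proof (cases "i \<in> I")
  case True
  then have "(\<lambda>w. w i) \<in> measurable (PiM I M) (M i)" by simp
  also have "measurable (PiM I M) (M i) = borel_measurable (PiM I M)"
    using assms[OF True] by (intro measurable_cong_sets) auto
  finally show ?thesis .
next
  case False
  have "(\<lambda>w. w i) \<in> borel_measurable (PiM I M) \<longleftrightarrow> (\<lambda>w. undefined :: 'a) \<in> borel_measurable (PiM I M)"
    by (rule measurable_cong) (use False in \<open>auto simp: space_PiM PiE_def extensional_def\<close>)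
  then show ?thesis by simp
qed

section \<open>The adaptively sampled reward table\<close>

locale greedy_run =
  fixes as :: "nat list" and k T :: nat and Q :: "nat \<Rightarrow> real measure"
  assumes nonempty: "as \<noteq> []" and dist: "distinct as" and arms: "set as \<subseteq> {..<k}"
    and prob: "\<And>i. i < k \<Longrightarrow> prob_space (Q i)"
    and sets_Q: "\<And>i. i < k \<Longrightarrow> sets (Q i) = sets borel"
begin

definition rewards :: "(nat \<times> nat \<Rightarrow> real) measure" where
  "rewards = PiM ({..<k} \<times> {..<T}) (\<lambda>(i, t). Q i)"

definition arm :: "nat \<Rightarrow> (nat \<times> nat \<Rightarrow> real) \<Rightarrow> nat" where
  "arm t w = greedy_policy as (curry w) t"

text \<open>This is the number of earlier pulls times the gap between the empirical mean and
  \<theta>. Unlike the mean, it changes additively and starts at 0.\<close>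

definition excess :: "real \<Rightarrow> nat \<Rightarrow> nat \<Rightarrow> (nat \<times> nat \<Rightarrow> real) \<Rightarrow> real" where
  "excess \<theta> i t w = (\<Sum>s<t. if arm s w = i then w (i, s) - \<theta> else 0)"

lemma arm_in: "arm t w \<in> set as" "arm t w < k"
  using greedy_policy_in_set[OF nonempty] arms by (auto simp: arm_def)

lemma excess_0 [simp]: "excess \<theta> i 0 w = 0"
  by (simp add: excess_def)

lemma excess_Suc:
  "excess \<theta> i (Suc t) w = excess \<theta> i t w + (if arm t w = i then w (i, t) - \<theta> else 0)"
  by (simp add: excess_def)

text \<open>Equality of \<open>s\<close> and \<open>t\<close> is included: the arm pulled at
  \<open>t\<close> is fixed before the reward at \<open>(i, t)\<close> is seen.\<close>

lemma arm_upd [simp]: "s \<le> t \<Longrightarrow> arm s (w((i, t) := y)) = arm s w"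
  unfolding arm_def by (rule greedy_policy_cong) auto

lemma excess_upd [simp]: "s \<le> t \<Longrightarrow> excess \<theta> j s (w((i, t) := y)) = excess \<theta> j s w"
  unfolding excess_def by (intro sum.cong) auto

lemma component_measurable: "(\<lambda>w. w p) \<in> borel_measurable rewards"
  unfolding rewards_def by (rule borel_measurable_PiM_component) (auto simp: sets_Q)

lemma greedy_next_measurable [measurable]:
  "(\<lambda>w. greedy_next as (curry w) h) \<in> measurable rewards (count_space UNIV)"
proof -
  define e where "e i w = emp_mean (curry w) h i" for i and w :: "nat \<times> nat \<Rightarrow> real"
  have [measurable]: "e i \<in> borel_measurable rewards" for i
    unfolding e_def emp_mean_def curry_def
    by (intro borel_measurable_divide borel_measurable_sum borel_measurable_const component_measurable)
  have "(\<lambda>w. LEAST j. j < length as \<and> (\<forall>l<length as. e (as ! l) w \<le> e (as ! j) w))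
      \<in> measurable rewards (count_space UNIV)"
    by (intro measurable_Least pred_intros_logic pred_intros_countable)
       (simp_all add: borel_measurable_pred_less pred_def borel_measurable_le)
  then have "(\<lambda>w. as ! (LEAST j. j < length as \<and> (\<forall>l<length as. e (as ! l) w \<le> e (as ! j) w)))
      \<in> measurable rewards (count_space UNIV)"
    by (rule measurable_compose) simp
  then show ?thesis
    unfolding greedy_next_def e_def[symmetric] by (cases "length h < length as") (simp_all only: if_True if_False measurable_const space_count_space UNIV_I)
qed

text \<open>Histories are lists of naturals, a countable type, so measurability reduces to the case
  of a fixed history.\<close>

lemma greedy_hist_measurable [measurable]:
  "(\<lambda>w. greedy_hist as (curry w) t) \<in> measurable rewards (count_space UNIV)"
proof (induction t)
  case (Suc t)
  note [measurable] = Suc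
  have "(\<lambda>w. greedy_hist as (curry w) t @ [greedy_next as (curry w) (greedy_hist as (curry w) t)])
      \<in> measurable rewards (count_space UNIV)"
    by (rule measurable_compose_countable[where g = "\<lambda>w. greedy_hist as (curry w) t"
          and f = "\<lambda>h w. h @ [greedy_next as (curry w) h]"]) measurable
  then show ?case unfolding greedy_hist.simps .
qed simp

lemma arm_measurable [measurable]: "arm t \<in> measurable rewards (count_space UNIV)"
  unfolding arm_def greedy_policy_def
  by (rule measurable_compose_countable[where g = "\<lambda>w. greedy_hist as (curry w) t"
        and f = "\<lambda>h w. greedy_next as (curry w) h"]) measurable

lemma excess_measurable [measurable]: "excess \<theta> i t \<in> borel_measurable rewards"
proof -
  have [measurable]: "(\<lambda>w. w (i, s)) \<in> borel_measurable rewards" for s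
    by (rule component_measurable)
  show ?thesis unfolding excess_def by measurable
qed

lemma prob_space_rewards: "prob_space rewards"
  unfolding rewards_def by (rule prob_space_PiM) (auto intro: prob)

text \<open>Adaptivity is handled by splitting on the arm pulled at \<open>t\<close>. On the event
  that it is \<open>i\<close>, the entry \<open>(i, t)\<close> is redrawn; the event does not depend
  on that entry, and finitely many such events cover the space.\<close>

lemma nn_integral_step_le:
  assumes f [measurable]: "f \<in> borel_measurable rewards" and g [measurable]: "g \<in> borel_measurable rewards"
    and "t < T"
    and le: "\<And>w i. w \<in> space rewards \<Longrightarrow> i \<in> set as \<Longrightarrow> arm t w = i \<Longrightarrow>
               (\<integral>\<^sup>+y. f (w((i, t) := y)) \<partial>Q i) \<le> g w"
  shows "(\<integral>\<^sup>+w. f w \<partial>rewards) \<le> (\<integral>\<^sup>+w. g w \<partial>rewards)"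
proof -
  have split: "h w = (\<Sum>i\<in>set as. if arm t w = i then h w else 0)" for h :: "_ \<Rightarrow> ennreal" and w
    using arm_in(1) by simp
  have "(\<integral>\<^sup>+w. f w \<partial>rewards) = (\<Sum>i\<in>set as. \<integral>\<^sup>+w. (if arm t w = i then f w else 0) \<partial>rewards)"
    by (subst nn_integral_sum[symmetric]) (measurable, rule nn_integral_cong, rule split)
  also have "\<dots> \<le> (\<Sum>i\<in>set as. \<integral>\<^sup>+w. (if arm t w = i then g w else 0) \<partial>rewards)"
  proof (rule sum_mono)
    fix i assume i: "i \<in> set as"
    define f' g' where "f' w = (if arm t w = i then f w else 0)"
      and "g' w = (if arm t w = i then g w else 0)" for w
    have meas: "f' \<in> borel_measurable rewards" "g' \<in> borel_measurable rewards"
      unfolding f'_def g'_def by measurable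
    have "(\<integral>\<^sup>+w. f' w \<partial>rewards) \<le> (\<integral>\<^sup>+w. g' w \<partial>rewards)"
      unfolding rewards_def
    proof (rule nn_integral_PiM_resample_le[where j = "(i, t)"])
      fix w assume "w \<in> space (PiM ({..<k} \<times> {..<T}) (\<lambda>(i, t). Q i))"
      then have w: "w \<in> space rewards" by (simp only: rewards_def)
      have "(\<integral>\<^sup>+y. f' (w((i, t) := y)) \<partial>Q i) \<le> g' w"
      proof (cases "arm t w = i")
        case True
        then show ?thesis using le[OF w i] by (simp add: f'_def g'_def)
      qed (simp add: f'_def)
      then show "(\<integral>\<^sup>+y. f' (w((i, t) := y)) \<partial>(case (i, t) of (i, t) \<Rightarrow> Q i)) \<le> g' w" by simp
    qed (use i arms \<open>t < T\<close> meas in \<open>auto simp: rewards_def intro: prob\<close>)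
    then show "(\<integral>\<^sup>+w. (if arm t w = i then f w else 0) \<partial>rewards) \<le> (\<integral>\<^sup>+w. (if arm t w = i then g w else 0) \<partial>rewards)"
      by (simp only: f'_def g'_def)
  qed
  also have "\<dots> = (\<integral>\<^sup>+w. g w \<partial>rewards)"
    by (subst nn_integral_sum[symmetric]) (measurable, rule nn_integral_cong, rule split[symmetric])
  finally show ?thesis .
qed

text \<open>Averaging over the entry revealed at \<open>t\<close> replaces a conditional
  expectation, so no filtration is set up.\<close>

lemma nn_integral_supermartingale:
  assumes meas: "\<And>t. F t \<in> borel_measurable rewards"
    and step: "\<And>t w i. t < T \<Longrightarrow> w \<in> space rewards \<Longrightarrow> i \<in> set as \<Longrightarrow> arm t w = i \<Longrightarrow>
               (\<integral>\<^sup>+y. F (Suc t) (w((i, t) := y)) \<partial>Q i) \<le> F t w"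
    and "t \<le> T"
  shows "(\<integral>\<^sup>+w. F t w \<partial>rewards) \<le> (\<integral>\<^sup>+w. F 0 w \<partial>rewards)"
  using \<open>t \<le> T\<close>
proof (induction t)
  case (Suc t)
  have "(\<integral>\<^sup>+w. F (Suc t) w \<partial>rewards) \<le> (\<integral>\<^sup>+w. F t w \<partial>rewards)"
    by (rule nn_integral_step_le[OF meas meas, of t]) (use Suc.prems step in auto)
  with Suc show ?case by simp
qed simp

section \<open>Pulls of bad arms at nonnegative excess\<close>

definition good_pulls :: "real \<Rightarrow> nat \<Rightarrow> nat \<Rightarrow> (nat \<times> nat \<Rightarrow> real) \<Rightarrow> real" where
  "good_pulls \<theta> j t w = (\<Sum>s<t. if arm s w = j \<and> 0 \<le> excess \<theta> j s w then 1 else 0)"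

lemma good_pulls_measurable [measurable]: "good_pulls \<theta> j t \<in> borel_measurable rewards"
  unfolding good_pulls_def by measurable

lemma good_pulls_nonneg: "0 \<le> good_pulls \<theta> j t w"
  unfolding good_pulls_def by (intro sum_nonneg) auto

lemma good_pulls_upd [simp]: "good_pulls \<theta> j t (w((i, t) := y)) = good_pulls \<theta> j t w"
  unfolding good_pulls_def by (intro sum.cong) auto

lemma good_pulls_Suc:
  "good_pulls \<theta> j (Suc t) w = good_pulls \<theta> j t w + (if arm t w = j \<and> 0 \<le> excess \<theta> j t w then 1 else 0)"
  by (simp add: good_pulls_def)

text \<open>Potential: the pulls counted so far plus \<open>exp (\<Delta> * excess) / (1 - exp (- \<Delta>\<^sup>2 / 2))\<close>.  Since
  \<open>exp (\<Delta> * excess)\<close> shrinks on average by the factor \<open>exp (- \<Delta>\<^sup>2 / 2)\<close> at each pull of the arm, the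
  loss pays for the next counted pull.\<close>

lemma nn_integral_good_pulls_le:
  assumes j: "j < k" and sub: "subgaussian1 (Q j) \<mu>" and "\<mu> < \<theta>"
  shows "(\<integral>\<^sup>+w. ennreal (good_pulls \<theta> j T w) \<partial>rewards) \<le> ennreal (1 / (1 - exp (- ((\<theta> - \<mu>)\<^sup>2 / 2))))"
proof -
  define \<Delta> where "\<Delta> = \<theta> - \<mu>"
  \<comment> \<open>\<open>K\<close> solves
    \<open>K * exp (- (\<Delta>\<^sup>2 / 2)) = K - 1\<close>, so a pull at excess \<open>r\<close>
    lowers the expected exponential term by at least \<open>exp (\<Delta> * r)\<close>, which is at
    least 1 whenever the pull is counted.\<close>
  define K where "K = 1 / (1 - exp (- (\<Delta>\<^sup>2 / 2)))"
  have \<Delta>: "0 < \<Delta>" using assms by (simp add: \<Delta>_def)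
  then have K: "0 < K" "K * exp (- (\<Delta>\<^sup>2 / 2)) = K - 1"
    by (simp_all add: K_def field_simps)
  define F where "F t w = ennreal (good_pulls \<theta> j t w + K * exp (\<Delta> * excess \<theta> j t w))" for t w
  interpret Qj: prob_space "Q j" by (rule prob[OF j])
  have [measurable_cong]: "sets (Q j) = sets borel" by (rule sets_Q[OF j])
  have "(\<integral>\<^sup>+w. ennreal (good_pulls \<theta> j T w) \<partial>rewards) \<le> (\<integral>\<^sup>+w. F T w \<partial>rewards)"
    using K by (intro nn_integral_mono) (simp add: F_def ennreal_leI)
  also have "\<dots> \<le> (\<integral>\<^sup>+w. F 0 w \<partial>rewards)"
  proof (rule nn_integral_supermartingale)
    show "F t \<in> borel_measurable rewards" for t unfolding F_def by measurable
    fix t w i assume "t < T" and i: "i \<in> set as" "arm t w = i"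
    show "(\<integral>\<^sup>+y. F (Suc t) (w((i, t) := y)) \<partial>Q i) \<le> F t w"
    proof (cases "i = j")
      case False
      interpret Qi: prob_space "Q i" using i arms by (intro prob) auto
      have "F (Suc t) (w((i, t) := y)) = F t w" for y
        using False i by (simp add: F_def excess_Suc good_pulls_Suc)
      then show ?thesis by (simp add: Qi.emeasure_space_1)
    next
      case True
      define r where "r = excess \<theta> j t w"
      \<comment> \<open>Whether the pull at \<open>t\<close> is counted depends on the excess before
        it, so the count at \<open>Suc t\<close> is constant in the new reward
        \<open>y\<close>.\<close>
      define c where "c = good_pulls \<theta> j (Suc t) w"
      have c: "0 \<le> c" unfolding c_def by (rule good_pulls_nonneg)
      have F_eq: "F (Suc t) (w((i, t) := y)) = ennreal (c + K * exp (\<Delta> * r - \<Delta>\<^sup>2) * exp (\<Delta> * (y - \<mu>)))" for y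
      proof -
        have "exp (\<Delta> * (r + (y - \<theta>))) = exp (\<Delta> * r - \<Delta>\<^sup>2) * exp (\<Delta> * (y - \<mu>))"
          unfolding exp_add[symmetric]
          by (rule arg_cong[where f = exp]) (simp add: \<Delta>_def algebra_simps power2_eq_square)
        then show ?thesis
          using i True by (simp add: F_def excess_Suc good_pulls_Suc r_def c_def mult.assoc)
      qed
      note mgf = subgaussian1_mgf[OF prob[OF j] sets_Q[OF j] sub, of \<Delta>]
      have eq: "(\<integral>\<^sup>+y. F (Suc t) (w((i, t) := y)) \<partial>Q i) =
          ennreal (\<integral>y. c + K * exp (\<Delta> * r - \<Delta>\<^sup>2) * exp (\<Delta> * (y - \<mu>)) \<partial>Q j)"
        unfolding F_eq unfolding True using mgf(1) c K by (intro nn_integral_eq_integral) auto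
      have "(\<integral>y. c + K * exp (\<Delta> * r - \<Delta>\<^sup>2) * exp (\<Delta> * (y - \<mu>)) \<partial>Q j) =
          c + K * exp (\<Delta> * r - \<Delta>\<^sup>2) * (\<integral>y. exp (\<Delta> * (y - \<mu>)) \<partial>Q j)"
        using mgf(1) by (simp add: Qj.prob_space)
      also have "\<dots> \<le> c + K * exp (\<Delta> * r - \<Delta>\<^sup>2) * exp (\<Delta>\<^sup>2 / 2)"
        using mgf(2) K by (intro add_left_mono mult_left_mono) auto
      also have "\<dots> = c + (K * exp (- (\<Delta>\<^sup>2 / 2))) * exp (\<Delta> * r)"
        by (simp add: mult.assoc exp_add[symmetric])
      also have "\<dots> = c - exp (\<Delta> * r) + K * exp (\<Delta> * r)"
        unfolding K by (simp add: algebra_simps)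
      also have "\<dots> \<le> good_pulls \<theta> j t w + K * exp (\<Delta> * r)"
      proof -
        have "c \<le> good_pulls \<theta> j t w + exp (\<Delta> * r)"
          using \<Delta> by (auto simp: c_def good_pulls_Suc r_def)
        then show ?thesis by simp
      qed
      finally show ?thesis unfolding eq by (simp only: F_def r_def ennreal_leI)
    qed
  qed simp
  also have "\<dots> = ennreal K"
    using prob_space.emeasure_space_1[OF prob_space_rewards] by (simp add: F_def good_pulls_def)
  finally show ?thesis by (simp add: K_def \<Delta>_def)
qed

section \<open>Survival of good arms\<close>

definition alive :: "real \<Rightarrow> nat \<Rightarrow> nat \<Rightarrow> (nat \<times> nat \<Rightarrow> real) \<Rightarrow> bool" where
  "alive \<theta> i t w \<longleftrightarrow> (\<forall>s\<le>t. 0 \<le> excess \<theta> i s w)"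

lemma alive_measurable [measurable]: "Measurable.pred rewards (alive \<theta> i t)"
  unfolding alive_def by measurable

lemma alive_upd [simp]: "alive \<theta> j t (w((i, t) := y)) = alive \<theta> j t w"
  unfolding alive_def by auto

lemma alive_Suc: "alive \<theta> i (Suc t) w \<longleftrightarrow> alive \<theta> i t w \<and> 0 \<le> excess \<theta> i (Suc t) w"
  unfolding alive_def by (auto simp: le_Suc_eq)

text \<open>The probability, given the past, that arm \<open>i\<close> eventually dies is at most one minus the
  survival minorant at its present excess.  Each pull affects a single factor of the product
  over the arms, so the product is a supermartingale although the arms are pulled adaptively.\<close>

lemma nn_integral_all_dead_le:
  assumes G: "G \<subseteq> set as" and surv: "\<And>i. i \<in> G \<Longrightarrow> survival_minorant (Q i) \<theta> (\<sigma> i)"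
  shows "(\<integral>\<^sup>+w. indicator {w. \<forall>i\<in>G. \<not> alive \<theta> i T w} w \<partial>rewards) \<le> ennreal (\<Prod>i\<in>G. 1 - \<sigma> i 0)"
proof -
  \<comment> \<open>A dead arm gets factor 1, so the product is 1 once all arms of \<open>G\<close>
    are dead; being nonnegative otherwise, it dominates the indicator.\<close>
  define \<phi> where "\<phi> i t w = (if alive \<theta> i t w then 1 - \<sigma> i (excess \<theta> i t w) else 1)" for i t w
  define F where "F t w = ennreal (\<Prod>i\<in>G. \<phi> i t w)" for t w
  have fin: "finite G" using G finite_subset by blast
  have \<sigma>: "\<sigma> i \<in> borel_measurable borel" "0 \<le> \<sigma> i r" "\<sigma> i r \<le> 1" "r < 0 \<Longrightarrow> \<sigma> i r = 0"
    "0 \<le> r \<Longrightarrow> \<sigma> i r \<le> (\<integral>x. \<sigma> i (r + (x - \<theta>)) \<partial>Q i)" if "i \<in> G" for i r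
    using surv[OF that] by (auto simp: survival_minorant_def)
  have \<phi>: "0 \<le> \<phi> i t w" if "i \<in> G" for i t w
    using \<sigma>(3)[OF that] by (simp add: \<phi>_def)
  have "(\<integral>\<^sup>+w. indicator {w. \<forall>i\<in>G. \<not> alive \<theta> i T w} w \<partial>rewards) \<le> (\<integral>\<^sup>+w. F T w \<partial>rewards)"
    by (intro nn_integral_mono) (auto simp: F_def \<phi>_def indicator_def)
  also have "\<dots> \<le> (\<integral>\<^sup>+w. F 0 w \<partial>rewards)"
  proof (rule nn_integral_supermartingale)
    have "(\<lambda>w. \<phi> i t w) \<in> borel_measurable rewards" if "i \<in> G" for i t
    proof -
      note [measurable] = \<sigma>(1)[OF that]
      show ?thesis unfolding \<phi>_def by measurable
    qed
    then show "F t \<in> borel_measurable rewards" for t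
      unfolding F_def by (intro measurable_compose[OF _ measurable_ennreal] borel_measurable_prod) auto
    fix t w i assume "t < T" and i: "i \<in> set as" "arm t w = i"
    interpret Qi: prob_space "Q i" using i arms by (intro prob) auto
    have sets_i [measurable_cong]: "sets (Q i) = sets borel" using i arms by (intro sets_Q) auto
    have other: "\<phi> j (Suc t) (w((i, t) := y)) = \<phi> j t w" if "j \<noteq> i" for j y
      using that i by (auto simp: \<phi>_def alive_Suc excess_Suc) (auto simp: alive_def)
    show "(\<integral>\<^sup>+y. F (Suc t) (w((i, t) := y)) \<partial>Q i) \<le> F t w"
    proof (cases "i \<in> G")
      case False
      have "F (Suc t) (w((i, t) := y)) = F t w" for y
        unfolding F_def using False by (intro arg_cong[where f = ennreal] prod.cong) (auto intro!: other)
      then show ?thesis by (simp add: Qi.emeasure_space_1)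
    next
      case True
      note [measurable] = \<sigma>(1)[OF True]
      define c where "c = (\<Prod>j\<in>G - {i}. \<phi> j t w)"
      define r where "r = excess \<theta> i t w"
      have c: "0 \<le> c" unfolding c_def by (intro prod_nonneg) (auto intro: \<phi>)
      have F_t: "F t w = ennreal (c * \<phi> i t w)"
        unfolding F_def c_def by (subst prod.remove[OF fin True]) (simp add: mult.commute)
      have F_Suc: "F (Suc t) (w((i, t) := y)) = ennreal (c * \<phi> i (Suc t) (w((i, t) := y)))" for y
        unfolding F_def c_def
        by (subst prod.remove[OF fin True]) (simp add: other mult.commute)
      have \<phi>_le: "(\<integral>\<^sup>+y. ennreal (\<phi> i (Suc t) (w((i, t) := y))) \<partial>Q i) \<le> ennreal (\<phi> i t w)"
      proof (cases "alive \<theta> i t w")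
        case False
        then show ?thesis by (simp add: \<phi>_def alive_Suc Qi.emeasure_space_1)
      next
        case alive: True
        then have r: "0 \<le> r" by (auto simp: alive_def r_def)
        \<comment> \<open>As \<open>\<sigma> i\<close> vanishes on negative arguments, one formula
          covers both survival and death at this pull.\<close>
        have "\<phi> i (Suc t) (w((i, t) := y)) = 1 - \<sigma> i (r + (y - \<theta>))" for y
          using alive i \<sigma>(4)[OF True] by (auto simp: \<phi>_def alive_Suc excess_Suc r_def)
        moreover have int: "integrable (Q i) (\<lambda>y. \<sigma> i (r + (y - \<theta>)))"
          by (rule Qi.integrable_in_unit) (measurable, auto simp: \<sigma>[OF True])
        ultimately have eq: "(\<integral>\<^sup>+y. ennreal (\<phi> i (Suc t) (w((i, t) := y))) \<partial>Q i)
            = ennreal (\<integral>y. 1 - \<sigma> i (r + (y - \<theta>)) \<partial>Q i)"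
          by (simp only:) (intro nn_integral_eq_integral; simp add: \<sigma>(3)[OF True])
        have "(\<integral>y. 1 - \<sigma> i (r + (y - \<theta>)) \<partial>Q i) = 1 - (\<integral>y. \<sigma> i (r + (y - \<theta>)) \<partial>Q i)"
          using int by (simp add: Qi.prob_space)
        also have "\<dots> \<le> \<phi> i t w"
          using alive \<sigma>(5)[OF True r] by (simp add: \<phi>_def r_def)
        finally show ?thesis unfolding eq by (rule ennreal_leI)
      qed
      have meas: "(\<lambda>y. ennreal (\<phi> i (Suc t) (w((i, t) := y)))) \<in> borel_measurable (Q i)"
      proof -
        have "excess \<theta> i (Suc t) (w((i, t) := y)) = r + (y - \<theta>)" for y
          using i by (simp add: excess_Suc r_def)
        then show ?thesis unfolding \<phi>_def alive_Suc by (simp cong: if_cong)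
      qed
      have "(\<integral>\<^sup>+y. F (Suc t) (w((i, t) := y)) \<partial>Q i)
          = ennreal c * (\<integral>\<^sup>+y. ennreal (\<phi> i (Suc t) (w((i, t) := y))) \<partial>Q i)"
        unfolding F_Suc using c \<phi>[OF True] meas
        by (simp add: ennreal_mult nn_integral_cmult)
      also have "\<dots> \<le> ennreal c * ennreal (\<phi> i t w)"
        by (rule mult_left_mono[OF \<phi>_le]) simp
      also have "\<dots> = F t w" using c \<phi>[OF True] by (simp add: F_t ennreal_mult)
      finally show ?thesis .
    qed
  qed simp
  also have "\<dots> = ennreal (\<Prod>i\<in>G. 1 - \<sigma> i 0)"
    using prob_space.emeasure_space_1[OF prob_space_rewards] by (simp add: F_def \<phi>_def alive_def)
  finally show ?thesis .
qed

end

section \<open>The cost of bad arms and the regret with fixed means\<close>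

definition gap_cost :: "real \<Rightarrow> real \<Rightarrow> real" where
  "gap_cost \<delta> m = (if m < 1 - 3 * \<delta> then 3 / ((1 - exp (-1)) / 2 * (1 - 2 * \<delta> - m)) else 0)"

lemma exp_minus_one_bounds: "1 / 4 \<le> exp (-1 :: real)" "exp (-1 :: real) < 1"
  using exp_le by (auto simp: exp_minus field_simps)

lemma gap_cost_measurable [measurable]: "gap_cost \<delta> \<in> borel_measurable borel"
  unfolding gap_cost_def by measurable

text \<open>The pull bound is of order 1/\<Delta>^2 with \<Delta> = 1 - 2\<delta> - m, and a pull
  costs 1 - m \<le> 3\<Delta> because \<delta> < \<Delta>; this leaves 3/(C \<Delta>). Arms within
  3\<delta> of 1 have cost 0 here, their regret being charged per round.\<close>

lemma gap_cost_ge: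
  assumes "0 < \<delta>" "0 \<le> m" "m < 1 - 3 * \<delta>"
  shows "(1 - m) * (1 / (1 - exp (- ((1 - 2 * \<delta> - m)\<^sup>2 / 2)))) \<le> gap_cost \<delta> m"
proof -
  define \<Delta> where "\<Delta> = 1 - 2 * \<delta> - m"
  define x where "x = \<Delta>\<^sup>2 / 2"
  define C where "C = (1 - exp (-1 :: real)) / 2"
  have C: "0 < C" "C \<le> 3 / 8" using exp_minus_one_bounds by (auto simp: C_def)
  have \<Delta>: "\<delta> < \<Delta>" "\<Delta> \<le> 1" "1 - m \<le> 3 * \<Delta>" using assms by (auto simp: \<Delta>_def)
  have x: "0 \<le> x" "x \<le> 1 / 2"
    using \<Delta> \<open>0 < \<delta>\<close> by (auto simp: x_def power_le_one)
  \<comment> \<open>For x \<le> 1/2 the quantity x - x^2/2 is at least 3x/4, and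
    \<open>C \<le> 3 / 8\<close> makes C \<Delta>^2 fit below that.\<close>
  have "C * \<Delta>\<^sup>2 \<le> 3 / 4 * x" using mult_right_mono[OF C(2), of "\<Delta>\<^sup>2"] by (simp add: x_def)
  also have "\<dots> \<le> x - x\<^sup>2 / 2"
    using mult_left_mono[OF x(2,1)] by (simp add: power2_eq_square)
  also have "\<dots> \<le> 1 - exp (- x)" by (rule one_minus_exp_ge) fact
  finally have denom: "C * \<Delta>\<^sup>2 \<le> 1 - exp (- x)" .
  have pos: "0 < C * \<Delta>\<^sup>2" using C \<Delta> \<open>0 < \<delta>\<close> by simp
  have "(1 - m) * (1 / (1 - exp (- x))) \<le> (3 * \<Delta>) * (1 / (C * \<Delta>\<^sup>2))"
    using \<Delta> denom pos assms x by (intro mult_mono) (auto simp: frac_le)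
  also have "\<dots> = 3 / (C * \<Delta>)" using \<Delta> \<open>0 < \<delta>\<close> by (simp add: power2_eq_square)
  finally show ?thesis using assms by (simp add: gap_cost_def \<Delta>_def x_def C_def)
qed

context greedy_run
begin

text \<open>After the initial round every listed arm has been pulled, so dividing by the positive
  number of pulls preserves the sign.\<close>

lemma excess_nonneg_iff:
  assumes "length as \<le> t" "a \<in> set as"
  shows "0 \<le> excess \<theta> a t w \<longleftrightarrow> \<theta> \<le> emp_mean (curry w) (greedy_hist as (curry w) t) a"
proof -
  let ?h = "greedy_hist as (curry w) t"
  define S where "S = {s. s < t \<and> arm s w = a}"
  have S: "{s. s < length ?h \<and> ?h ! s = a} = S"
    by (auto simp: S_def greedy_hist_nth arm_def)
  obtain l where l: "l < length as" "as ! l = a" using assms(2) by (auto simp: in_set_conv_nth)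
  then have "l \<in> S" using assms(1) by (simp add: S_def arm_def greedy_policy_initial)
  moreover have fin: "finite S" by (simp add: S_def)
  ultimately have card: "0 < card S" by (auto simp: card_gt_0_iff)
  have "excess \<theta> a t w = (\<Sum>s\<in>S. w (a, s) - \<theta>)"
    unfolding excess_def S_def by (subst sum.inter_filter[symmetric]) (auto intro!: sum.cong)
  also have "\<dots> = (\<Sum>s\<in>S. w (a, s)) - real (card S) * \<theta>" by (simp add: sum_subtractf)
  finally have sum: "excess \<theta> a t w = (\<Sum>s\<in>S. w (a, s)) - real (card S) * \<theta>" .
  show ?thesis
    unfolding sum emp_mean_def S using card by (simp add: field_simps)
qed

text \<open>In the initial round the pulled arm is new and its excess is 0. Later its empirical mean
  is at least that of the living arm \<open>i\<close>, hence at least \<theta>.\<close>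

lemma excess_arm_nonneg:
  assumes "i \<in> set as" "alive \<theta> i T w" "t < T"
  shows "0 \<le> excess \<theta> (arm t w) t w"
proof (cases "t < length as")
  case True
  have "arm s w \<noteq> arm t w" if "s < t" for s
    using that True dist by (simp add: arm_def greedy_policy_initial nth_eq_iff_index_eq)
  then show ?thesis by (simp add: excess_def)
next
  case False
  then have t: "length as \<le> t" by simp
  let ?h = "greedy_hist as (curry w) t"
  have "\<theta> \<le> emp_mean (curry w) ?h i"
    using assms t by (simp add: excess_nonneg_iff[symmetric] alive_def)
  also have "\<dots> \<le> emp_mean (curry w) ?h (arm t w)"
    unfolding arm_def greedy_policy_def using nonempty t assms(1) by (intro greedy_next_argmax) auto
  finally show ?thesis using t arm_in by (simp add: excess_nonneg_iff)
qed

text \<open>A pathwise comparison with the upper bound 1 of the means. If all of \<open>G\<close> is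
  dead, the regret is at most \<open>T\<close>. Otherwise every pulled arm has nonnegative excess,
  so each pull either costs at most 3\<delta> or is a counted pull of an arm below 1 -
  3\<delta>.\<close>

lemma regret_le:
  assumes \<mu>: "\<And>i. i < k \<Longrightarrow> 0 \<le> \<mu> i \<and> \<mu> i \<le> 1" and "0 \<le> \<delta>" and G: "G \<subseteq> set as"
  shows "real T * (MAX i\<in>{..<k}. \<mu> i) - (\<Sum>t<T. \<mu> (arm t w))
    \<le> real T * indicator {w. \<forall>i\<in>G. \<not> alive \<theta> i T w} w + 3 * \<delta> * real T
      + (\<Sum>j\<in>{j \<in> set as. \<mu> j < 1 - 3 * \<delta>}. (1 - \<mu> j) * good_pulls \<theta> j T w)"
    (is "?lhs \<le> ?dead + _ + ?sum")
proof -
  let ?B = "{j \<in> set as. \<mu> j < 1 - 3 * \<delta>}"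
  have as: "i \<in> set as \<Longrightarrow> i < k" for i using arms by auto
  have "(MAX i\<in>{..<k}. \<mu> i) \<le> 1"
    using as[of "hd as"] nonempty by (subst Max_le_iff) (auto simp: \<mu>)
  from mult_left_mono[OF this, of "real T"]
  have lhs: "?lhs \<le> (\<Sum>t<T. 1 - \<mu> (arm t w))" by (simp add: sum_subtractf)
  have sum_nonneg: "0 \<le> ?sum"
    by (intro sum_nonneg mult_nonneg_nonneg good_pulls_nonneg) (auto simp: \<mu> as)
  show ?thesis
  proof (cases "\<forall>i\<in>G. \<not> alive \<theta> i T w")
    case True
    have "(\<Sum>t<T. 1 - \<mu> (arm t w)) \<le> (\<Sum>t<T. 1)"
      by (intro sum_mono) (use \<mu> arm_in in auto)
    then show ?thesis using lhs sum_nonneg True \<open>0 \<le> \<delta>\<close> by (simp add: add_increasing2)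
  next
    case False
    then obtain i where i: "i \<in> set as" "alive \<theta> i T w" using G by auto
    have "(\<Sum>t<T. 1 - \<mu> (arm t w)) \<le>
        (\<Sum>t<T. 3 * \<delta> + (\<Sum>j\<in>?B. (1 - \<mu> j) * (if arm t w = j \<and> 0 \<le> excess \<theta> j t w then 1 else 0)))"
    proof (rule sum_mono)
      fix t assume "t \<in> {..<T}"
      then have ex: "0 \<le> excess \<theta> (arm t w) t w" using excess_arm_nonneg[OF i] by simp
      have "(\<Sum>j\<in>?B. (1 - \<mu> j) * (if arm t w = j \<and> 0 \<le> excess \<theta> j t w then 1 else 0)) =
          (\<Sum>j\<in>?B. if j = arm t w then 1 - \<mu> j else 0)"
        using ex by (intro sum.cong) auto
      also have "\<dots> = (if arm t w \<in> ?B then 1 - \<mu> (arm t w) else 0)"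
        by (subst sum.delta) auto
      finally show "1 - \<mu> (arm t w) \<le>
          3 * \<delta> + (\<Sum>j\<in>?B. (1 - \<mu> j) * (if arm t w = j \<and> 0 \<le> excess \<theta> j t w then 1 else 0))"
        using arm_in(1)[of t w] \<open>0 \<le> \<delta>\<close> by auto
    qed
    also have "\<dots> = 3 * \<delta> * real T + ?sum"
      unfolding good_pulls_def sum_distrib_left
      by (subst sum.swap) (simp add: sum.distrib sum.swap[of _ "{..<T}"])
    finally show ?thesis using lhs False by simp
  qed
qed

lemma nn_integral_regret_le:
  assumes \<mu>: "\<And>i. i < k \<Longrightarrow> 0 \<le> \<mu> i \<and> \<mu> i \<le> 1" and \<delta>: "0 < \<delta>" and q: "q \<le> 1"
    and sub: "\<And>i. i < k \<Longrightarrow> subgaussian1 (Q i) (\<mu> i)"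
    and surv: "\<And>i. i < k \<Longrightarrow> 1 - \<delta> \<le> \<mu> i \<Longrightarrow>
                 \<exists>\<sigma>. survival_minorant (Q i) (1 - 2 * \<delta>) \<sigma> \<and> q \<le> \<sigma> 0"
  shows "(\<integral>\<^sup>+w. ennreal (real T * (MAX i\<in>{..<k}. \<mu> i) - (\<Sum>t<T. \<mu> (arm t w))) \<partial>rewards)
    \<le> ennreal (real T) * (\<Prod>i\<in>set as. ennreal (if 1 - \<delta> \<le> \<mu> i then 1 - q else 1))
      + ennreal (3 * \<delta> * real T) + (\<Sum>j\<in>set as. ennreal (gap_cost \<delta> (\<mu> j)))"
proof -
  let ?\<theta> = "1 - 2 * \<delta>"
  let ?B = "{j \<in> set as. \<mu> j < 1 - 3 * \<delta>}"
  have as: "i \<in> set as \<Longrightarrow> i < k" for i using arms by auto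
  define G where "G = {i \<in> set as. 1 - \<delta> \<le> \<mu> i}"
  have G: "G \<subseteq> set as" by (auto simp: G_def)
  have "\<exists>\<sigma>. survival_minorant (Q i) ?\<theta> \<sigma> \<and> q \<le> \<sigma> 0" if "i \<in> G" for i
    using that by (intro surv) (auto simp: G_def as)
  then obtain \<sigma> where \<sigma>: "\<And>i. i \<in> G \<Longrightarrow> survival_minorant (Q i) ?\<theta> (\<sigma> i)" "\<And>i. i \<in> G \<Longrightarrow> q \<le> \<sigma> i 0"
    by metis
  have fin: "finite G" using G finite_subset by blast
  then have [measurable]: "Measurable.pred rewards (\<lambda>w. \<forall>i\<in>G. \<not> alive ?\<theta> i T w)"
    by (intro pred_intros_finite) measurable
  have "(\<integral>\<^sup>+w. ennreal (real T * (MAX i\<in>{..<k}. \<mu> i) - (\<Sum>t<T. \<mu> (arm t w))) \<partial>rewards)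
    \<le> (\<integral>\<^sup>+w. (ennreal (real T) * indicator {w. \<forall>i\<in>G. \<not> alive ?\<theta> i T w} w + ennreal (3 * \<delta> * real T))
        + (\<Sum>j\<in>?B. ennreal (1 - \<mu> j) * ennreal (good_pulls ?\<theta> j T w)) \<partial>rewards)"
  proof (rule nn_integral_mono)
    fix w
    have "ennreal (real T * (MAX i\<in>{..<k}. \<mu> i) - (\<Sum>t<T. \<mu> (arm t w))) \<le>
        ennreal (real T * indicator {w. \<forall>i\<in>G. \<not> alive ?\<theta> i T w} w + 3 * \<delta> * real T
          + (\<Sum>j\<in>?B. (1 - \<mu> j) * good_pulls ?\<theta> j T w))"
      using \<delta> by (intro ennreal_leI regret_le \<mu> G) auto
    also have "\<dots> = (ennreal (real T) * indicator {w. \<forall>i\<in>G. \<not> alive ?\<theta> i T w} w + ennreal (3 * \<delta> * real T))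
        + (\<Sum>j\<in>?B. ennreal (1 - \<mu> j) * ennreal (good_pulls ?\<theta> j T w))"
    proof -
      have "(\<Sum>j\<in>?B. ennreal (1 - \<mu> j) * ennreal (good_pulls ?\<theta> j T w)) =
          ennreal (\<Sum>j\<in>?B. (1 - \<mu> j) * good_pulls ?\<theta> j T w)"
        by (subst sum_ennreal[symmetric])
           (auto simp: as \<mu> good_pulls_nonneg ennreal_mult intro!: mult_nonneg_nonneg sum.cong)
      moreover have "0 \<le> (\<Sum>j\<in>?B. (1 - \<mu> j) * good_pulls ?\<theta> j T w)"
        by (intro sum_nonneg mult_nonneg_nonneg good_pulls_nonneg) (auto simp: \<mu> as)
      ultimately show ?thesis
        using \<delta> by (simp add: ennreal_mult'' indicator_def)
    qed
    finally show "ennreal (real T * (MAX i\<in>{..<k}. \<mu> i) - (\<Sum>t<T. \<mu> (arm t w))) \<le>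
        (ennreal (real T) * indicator {w. \<forall>i\<in>G. \<not> alive ?\<theta> i T w} w + ennreal (3 * \<delta> * real T))
        + (\<Sum>j\<in>?B. ennreal (1 - \<mu> j) * ennreal (good_pulls ?\<theta> j T w))" .
  qed
  also have "\<dots> = ennreal (real T) * (\<integral>\<^sup>+w. indicator {w. \<forall>i\<in>G. \<not> alive ?\<theta> i T w} w \<partial>rewards)
      + ennreal (3 * \<delta> * real T)
      + (\<Sum>j\<in>?B. ennreal (1 - \<mu> j) * (\<integral>\<^sup>+w. ennreal (good_pulls ?\<theta> j T w) \<partial>rewards))"
    by (simp add: nn_integral_add nn_integral_sum nn_integral_cmult indicator_def
          prob_space.emeasure_space_1[OF prob_space_rewards])
  also have "\<dots> \<le> ennreal (real T) * (\<Prod>i\<in>set as. ennreal (if 1 - \<delta> \<le> \<mu> i then 1 - q else 1))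
      + ennreal (3 * \<delta> * real T) + (\<Sum>j\<in>set as. ennreal (gap_cost \<delta> (\<mu> j)))"
  proof (intro add_mono mult_left_mono order_refl)
    have "(\<integral>\<^sup>+w. indicator {w. \<forall>i\<in>G. \<not> alive ?\<theta> i T w} w \<partial>rewards) \<le> ennreal (\<Prod>i\<in>G. 1 - \<sigma> i 0)"
      by (rule nn_integral_all_dead_le[OF G \<sigma>(1)])
    also have "\<dots> \<le> ennreal (\<Prod>i\<in>G. 1 - q)"
    proof (intro ennreal_leI prod_mono conjI)
      show "0 \<le> 1 - \<sigma> i 0" if "i \<in> G" for i using \<sigma>(1)[OF that] by (simp add: survival_minorant_def)
      show "1 - \<sigma> i 0 \<le> 1 - q" if "i \<in> G" for i using \<sigma>(2)[OF that] by simp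
    qed
    \<comment> \<open>Inserting factors 1 makes the index set independent of the means, so that the
      product can be integrated factor by factor over the prior.\<close>
    also have "(\<Prod>i\<in>G. 1 - q) = (\<Prod>i\<in>set as. if 1 - \<delta> \<le> \<mu> i then 1 - q else 1)"
      unfolding G_def by (rule prod.inter_filter) simp
    also have "ennreal \<dots> = (\<Prod>i\<in>set as. ennreal (if 1 - \<delta> \<le> \<mu> i then 1 - q else 1))"
      using q by (subst prod_ennreal) auto
    finally show "(\<integral>\<^sup>+w. indicator {w. \<forall>i\<in>G. \<not> alive ?\<theta> i T w} w \<partial>rewards)
        \<le> (\<Prod>i\<in>set as. ennreal (if 1 - \<delta> \<le> \<mu> i then 1 - q else 1))" .
    have "(\<Sum>j\<in>?B. ennreal (1 - \<mu> j) * (\<integral>\<^sup>+w. ennreal (good_pulls ?\<theta> j T w) \<partial>rewards))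
        \<le> (\<Sum>j\<in>?B. ennreal (gap_cost \<delta> (\<mu> j)))"
    proof (rule sum_mono)
      fix j assume j: "j \<in> ?B"
      then have jk: "j < k" by (simp add: as)
      have "ennreal (1 - \<mu> j) * (\<integral>\<^sup>+w. ennreal (good_pulls ?\<theta> j T w) \<partial>rewards)
          \<le> ennreal (1 - \<mu> j) * ennreal (1 / (1 - exp (- ((?\<theta> - \<mu> j)\<^sup>2 / 2))))"
        using j \<delta> by (intro mult_left_mono nn_integral_good_pulls_le[OF jk sub[OF jk]]) auto
      also have "\<dots> = ennreal ((1 - \<mu> j) * (1 / (1 - exp (- ((?\<theta> - \<mu> j)\<^sup>2 / 2)))))"
        using \<mu>[OF jk] by (subst ennreal_mult) auto
      also have "\<dots> \<le> ennreal (gap_cost \<delta> (\<mu> j))"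
        using j \<delta> \<mu>[OF jk] by (intro ennreal_leI gap_cost_ge) auto
      finally show "ennreal (1 - \<mu> j) * (\<integral>\<^sup>+w. ennreal (good_pulls ?\<theta> j T w) \<partial>rewards)
          \<le> ennreal (gap_cost \<delta> (\<mu> j))" .
    qed
    also have "\<dots> \<le> (\<Sum>j\<in>set as. ennreal (gap_cost \<delta> (\<mu> j)))"
      by (rule sum_mono2) auto
    finally show "(\<Sum>j\<in>?B. ennreal (1 - \<mu> j) * (\<integral>\<^sup>+w. ennreal (good_pulls ?\<theta> j T w) \<partial>rewards))
        \<le> (\<Sum>j\<in>set as. ennreal (gap_cost \<delta> (\<mu> j)))" .
  qed simp
  finally show ?thesis .
qed

end

text \<open>Layer-cake argument: with \<Delta> = 1 - 2\<delta> - m, the value 1/\<Delta> is 1 plus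
  the integral of 1/v^2 over [\<Delta>, 1]. Exchanging integrals brings in the prior mass above 1 -
  v - 2\<delta>, at most C0 (v + 2\<delta>) by regularity; integrating (v + 2\<delta>)/v^2 over
  [\<delta>, 1] yields the logarithm.\<close>

lemma nn_integral_gap_cost_le:
  assumes \<Gamma>: "prob_space \<Gamma>" and sets [measurable_cong]: "sets \<Gamma> = sets borel" and supp: "emeasure \<Gamma> {0..1} = 1"
    and reg: "one_regular \<Gamma> c0 C0" and \<delta>: "0 < \<delta>" "\<delta> \<le> 1"
  shows "(\<integral>\<^sup>+m. ennreal (gap_cost \<delta> m) \<partial>\<Gamma>)
           \<le> ennreal (3 * C0 / ((1 - exp (-1)) / 2) * (3 - ln \<delta>))"
proof -
  interpret \<Gamma>: prob_space \<Gamma> by fact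
  interpret pair_sigma_finite lborel \<Gamma> ..
  define C where "C = (1 - exp (-1 :: real)) / 2"
  have C: "0 < C" using exp_minus_one_bounds by (simp add: C_def)
  have up: "measure \<Gamma> {1 - e..} \<le> C0 * e" if "0 < e" "e \<le> 1" for e
    using reg that by (auto simp: one_regular_def)
  have "1 \<le> C0"
  proof -
    have "1 = measure \<Gamma> {0..1}" using supp by (simp add: measure_def)
    also have "\<dots> \<le> measure \<Gamma> {1 - 1..}" by (rule \<Gamma>.finite_measure_mono) (auto simp: sets)
    also have "\<dots> \<le> C0" using up[of 1] by simp
    finally show ?thesis .
  qed
  \<comment> \<open>The regularity bound is extended past 1 because v + 2\<delta> can exceed
    1.\<close>
  have measure_atLeast: "measure \<Gamma> {1 - x..} \<le> C0 * x" if "0 < x" for x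
  proof (cases "x \<le> 1")
    case False
    have "measure \<Gamma> {1 - x..} \<le> 1 * 1" by simp
    also have "\<dots> \<le> C0 * x" using False \<open>1 \<le> C0\<close> by (intro mult_mono) auto
    finally show ?thesis .
  qed (use that up in auto)
  \<comment> \<open>For m < 1 - 3\<delta> the constraint \<delta> \<le> v follows from \<Delta>
    \<le> v; stated explicitly, it keeps \<open>v\<close> away from 0 for every
    \<open>m\<close>.\<close>
  define slab where "slab v m = (if \<delta> \<le> v \<and> v \<le> 1 \<and> 1 - 2 * \<delta> - v \<le> m then ennreal (1 / v\<^sup>2) else 0)"
    for v m :: real
  have [measurable]: "(\<lambda>(v, m). slab v m) \<in> borel_measurable (lborel \<Otimes>\<^sub>M \<Gamma>)"
    unfolding slab_def by measurable
  have pointwise: "ennreal (gap_cost \<delta> m) \<le> ennreal (3 / C) * (1 + (\<integral>\<^sup>+v. slab v m \<partial>lborel))"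
    if "m \<in> {0..1}" for m
  proof (cases "m < 1 - 3 * \<delta>")
    case True
    define \<Delta> where "\<Delta> = 1 - 2 * \<delta> - m"
    have \<Delta>: "\<delta> < \<Delta>" "\<Delta> \<le> 1" "0 < \<Delta>" using True that \<delta> by (auto simp: \<Delta>_def)
    have "(\<integral>\<^sup>+v. slab v m \<partial>lborel) = (\<integral>\<^sup>+v. ennreal (1 / v\<^sup>2) * indicator {\<Delta>..1} v \<partial>lborel)"
      using \<Delta> by (intro nn_integral_cong) (auto simp: slab_def \<Delta>_def indicator_def)
    also have "\<dots> = ennreal (- 1 / 1 - (- 1 / \<Delta>))"
      using \<Delta> by (intro nn_integral_FTC_Icc)
        (auto intro!: derivative_eq_intros simp: power2_eq_square)
    finally have "1 + (\<integral>\<^sup>+v. slab v m \<partial>lborel) = ennreal (1 / \<Delta>)"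
      using \<Delta> by (simp add: ennreal_plus[symmetric] ennreal_1[symmetric] del: ennreal_plus ennreal_1)
    then have "ennreal (3 / C) * (1 + (\<integral>\<^sup>+v. slab v m \<partial>lborel)) = ennreal (3 / C * (1 / \<Delta>))"
      using C \<Delta> by (subst ennreal_mult) simp_all
    also have "3 / C * (1 / \<Delta>) = gap_cost \<delta> m"
      using True by (simp add: gap_cost_def C_def \<Delta>_def)
    finally show ?thesis by simp
  qed (simp add: gap_cost_def)
  have "(\<integral>\<^sup>+m. \<integral>\<^sup>+v. slab v m \<partial>lborel \<partial>\<Gamma>) = (\<integral>\<^sup>+v. \<integral>\<^sup>+m. slab v m \<partial>\<Gamma> \<partial>lborel)"
    by (rule Fubini') measurable
  also have "\<dots> \<le> (\<integral>\<^sup>+v. ennreal (C0 * (v + 2 * \<delta>) / v\<^sup>2) * indicator {\<delta>..1} v \<partial>lborel)"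
  proof (rule nn_integral_mono)
    fix v :: real
    show "(\<integral>\<^sup>+m. slab v m \<partial>\<Gamma>) \<le> ennreal (C0 * (v + 2 * \<delta>) / v\<^sup>2) * indicator {\<delta>..1} v"
    proof (cases "v \<in> {\<delta>..1}")
      case True
      have "(\<integral>\<^sup>+m. slab v m \<partial>\<Gamma>) = (\<integral>\<^sup>+m. ennreal (1 / v\<^sup>2) * indicator {1 - (v + 2 * \<delta>)..} m \<partial>\<Gamma>)"
        using True by (intro nn_integral_cong) (auto simp: slab_def indicator_def)
      also have "\<dots> = ennreal (1 / v\<^sup>2) * ennreal (measure \<Gamma> {1 - (v + 2 * \<delta>)..})"
        by (subst nn_integral_cmult_indicator) (auto simp: sets \<Gamma>.emeasure_eq_measure)
      also have "\<dots> \<le> ennreal (1 / v\<^sup>2) * ennreal (C0 * (v + 2 * \<delta>))"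
        using True \<delta> by (intro mult_left_mono ennreal_leI measure_atLeast) auto
      also have "\<dots> = ennreal (C0 * (v + 2 * \<delta>) / v\<^sup>2)"
        by (subst ennreal_mult'[symmetric]) auto
      finally show ?thesis using True by simp
    next
      case False
      then have "slab v m = 0" for m by (auto simp: slab_def)
      then show ?thesis by simp
    qed
  qed
  also have "\<dots> = ennreal (C0 * (ln 1 - 2 * \<delta> / 1) - C0 * (ln \<delta> - 2 * \<delta> / \<delta>))"
  proof (rule nn_integral_FTC_Icc[where F = "\<lambda>v. C0 * (ln v - 2 * \<delta> / v)"])
    fix v :: real assume v: "v \<in> {\<delta>..1}"
    then have "\<delta> \<le> v" by simp
    then show "((\<lambda>v. C0 * (ln v - 2 * \<delta> / v)) has_real_derivative C0 * (v + 2 * \<delta>) / v\<^sup>2) (at v)"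
      using \<delta> by (auto intro!: derivative_eq_intros simp: power2_eq_square field_simps)
    show "0 \<le> C0 * (v + 2 * \<delta>) / v\<^sup>2" using \<open>\<delta> \<le> v\<close> \<delta> \<open>1 \<le> C0\<close> by simp
  qed (use \<delta> in auto)
  finally have slab_total: "(\<integral>\<^sup>+m. \<integral>\<^sup>+v. slab v m \<partial>lborel \<partial>\<Gamma>)
      \<le> ennreal (C0 * (ln 1 - 2 * \<delta> / 1) - C0 * (ln \<delta> - 2 * \<delta> / \<delta>))" .
  have "(\<integral>\<^sup>+m. ennreal (gap_cost \<delta> m) \<partial>\<Gamma>) \<le> (\<integral>\<^sup>+m. ennreal (3 / C) * (1 + (\<integral>\<^sup>+v. slab v m \<partial>lborel)) \<partial>\<Gamma>)"
  proof (rule nn_integral_mono_AE)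
    have "AE m in \<Gamma>. m \<in> {0..1}"
      using supp by (subst \<Gamma>.AE_in_set_eq_1) (auto simp: sets measure_def)
    then show "AE m in \<Gamma>. ennreal (gap_cost \<delta> m) \<le> ennreal (3 / C) * (1 + (\<integral>\<^sup>+v. slab v m \<partial>lborel))"
      by eventually_elim (rule pointwise)
  qed
  also have "\<dots> = ennreal (3 / C) * (1 + (\<integral>\<^sup>+m. \<integral>\<^sup>+v. slab v m \<partial>lborel \<partial>\<Gamma>))"
    by (simp add: nn_integral_cmult nn_integral_add \<Gamma>.emeasure_space_1)
  also have "\<dots> \<le> ennreal (3 / C) * (1 + ennreal (C0 * (ln 1 - 2 * \<delta> / 1) - C0 * (ln \<delta> - 2 * \<delta> / \<delta>)))"
    by (intro mult_left_mono add_left_mono slab_total) simp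
  also have "\<dots> \<le> ennreal (3 / C) * ennreal (1 + C0 * (2 - ln \<delta>))"
  proof (intro mult_left_mono)
    have "C0 * (ln 1 - 2 * \<delta> / 1) - C0 * (ln \<delta> - 2 * \<delta> / \<delta>) = C0 * (2 - ln \<delta> - 2 * \<delta>)"
      using \<delta> by (simp add: algebra_simps)
    also have "\<dots> \<le> C0 * (2 - ln \<delta>)" using \<delta> \<open>1 \<le> C0\<close> by (intro mult_left_mono) auto
    finally have "ennreal (C0 * (ln 1 - 2 * \<delta> / 1) - C0 * (ln \<delta> - 2 * \<delta> / \<delta>)) \<le> ennreal (C0 * (2 - ln \<delta>))"
      by (rule ennreal_leI)
    moreover have "0 \<le> C0 * (2 - ln \<delta>)"
    proof -
      have "ln \<delta> \<le> 0" using \<delta> by simp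
      then show ?thesis using \<open>1 \<le> C0\<close> by simp
    qed
    then have "ennreal (1 + C0 * (2 - ln \<delta>)) = 1 + ennreal (C0 * (2 - ln \<delta>))"
      by (subst ennreal_plus) auto
    ultimately show "1 + ennreal (C0 * (ln 1 - 2 * \<delta> / 1) - C0 * (ln \<delta> - 2 * \<delta> / \<delta>)) \<le> ennreal (1 + C0 * (2 - ln \<delta>))"
      by (simp add: add_left_mono)
  qed simp
  also have "\<dots> = ennreal (3 / C * (1 + C0 * (2 - ln \<delta>)))"
    using C by (subst ennreal_mult') auto
  also have "\<dots> \<le> ennreal (3 / C * (C0 * (3 - ln \<delta>)))"
    using C \<open>1 \<le> C0\<close> by (intro ennreal_leI mult_left_mono) (auto simp: algebra_simps)
  also have "3 / C * (C0 * (3 - ln \<delta>)) = 3 * C0 / C * (3 - ln \<delta>)" by simp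
  finally show ?thesis by (simp add: C_def)
qed

subsection \<open>Averaging over the prior\<close>

locale bandit =
  fixes \<Gamma> :: "real measure" and P :: "real \<Rightarrow> real measure" and c0 C0 p0 \<delta>0 :: real
  assumes \<Gamma>: "prob_space \<Gamma>" and sets_\<Gamma>: "sets \<Gamma> = sets borel" and supp: "emeasure \<Gamma> {0..1} = 1"
    and c0: "0 < c0" and regular: "one_regular \<Gamma> c0 C0"
    and P_prob: "\<And>\<mu>. \<mu> \<in> {0..1} \<Longrightarrow> prob_space (P \<mu>) \<and> sets (P \<mu>) = sets borel"
    and P_sub: "\<And>\<mu>. \<mu> \<in> {0..1} \<Longrightarrow> subgaussian1 (P \<mu>) \<mu>"
    and p0: "0 < p0" and upward: "uniformly_upward_looking P p0 \<delta>0"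
begin

interpretation \<Gamma>: prob_space \<Gamma> by (rule \<Gamma>)
interpretation prior: product_prob_space "\<lambda>_::nat. \<Gamma>" ..

lemma C0_nonneg: "0 \<le> C0"
proof -
  have "0 \<le> measure \<Gamma> {1 - 1..}" by simp
  also have "\<dots> \<le> C0 * 1" using regular by (auto simp: one_regular_def dest: spec[of _ 1])
  finally show ?thesis by simp
qed

lemma c0_le_one: "c0 \<le> 1"
proof -
  have "c0 * 1 \<le> measure \<Gamma> {1 - 1<..}" using regular by (auto simp: one_regular_def dest: spec[of _ 1])
  also have "\<dots> \<le> 1" by simp
  finally show ?thesis by simp
qed

text \<open>The drift above \<theta> = 1 - 2\<delta> lies between \<delta> and 2\<delta>; the upper
  end must not exceed 1/10, hence \<delta> \<le> 1/20.\<close>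

lemma survival_minorant_exists:
  assumes "0 < \<delta>" "\<delta> \<le> 1 / 20" "\<delta> \<le> \<delta>0" "1 - \<delta> \<le> \<mu>" "\<mu> \<le> 1"
  shows "\<exists>\<sigma>. survival_minorant (P \<mu>) (1 - 2 * \<delta>) \<sigma> \<and> p0 * \<delta> / 2 \<le> \<sigma> 0"
proof -
  have "upward_looking (P \<mu>) \<mu> p0"
    using upward assms by (auto simp: uniformly_upward_looking_def)
  then obtain \<sigma> where "survival_minorant (P \<mu>) (1 - 2 * \<delta>) \<sigma>" "p0 * (\<mu> - (1 - 2 * \<delta>)) / 2 \<le> \<sigma> 0"
    using upward_looking_survival_minorant[of "P \<mu>" \<mu> p0 "1 - 2 * \<delta>"] assms p0 by auto
  moreover have "p0 * \<delta> \<le> p0 * (\<mu> - (1 - 2 * \<delta>))"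
    using assms p0 by (intro mult_left_mono) auto
  ultimately show ?thesis by (intro exI[of _ \<sigma>]) auto
qed

text \<open>An arm of mean 1 has a minorant whose value at 0 is at least this number, and minorants
  are at most 1. Thus \<open>1 - q\<close> is a valid factor later.\<close>

lemma survival_le_one:
  assumes "0 < \<delta>" "\<delta> \<le> 1 / 20" "\<delta> \<le> \<delta>0"
  shows "p0 * \<delta> / 2 \<le> 1"
  using survival_minorant_exists[OF assms, of 1] assms
  by (force simp: survival_minorant_def intro: order_trans)

lemma nn_integral_survival_factor_le:
  assumes "0 < \<delta>" "\<delta> \<le> 1" "0 \<le> q" "q \<le> 1"
  shows "(\<integral>\<^sup>+m. ennreal (if 1 - \<delta> \<le> m then 1 - q else 1) \<partial>\<Gamma>) \<le> ennreal (1 - q * (c0 * \<delta>))"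
proof -
  note [measurable_cong] = sets_\<Gamma>
  have set: "{1 - \<delta>..} \<in> sets \<Gamma>" by (simp add: sets_\<Gamma>)
  have "(\<integral>\<^sup>+m. ennreal (if 1 - \<delta> \<le> m then 1 - q else 1) \<partial>\<Gamma>) =
      (\<integral>\<^sup>+m. ennreal (1 - q * indicator {1 - \<delta>..} m) \<partial>\<Gamma>)"
    by (intro nn_integral_cong) auto
  also have "\<dots> = ennreal (\<integral>m. 1 - q * indicator {1 - \<delta>..} m \<partial>\<Gamma>)"
    using assms set
    by (intro nn_integral_eq_integral) (auto simp: indicator_def[of "{1 - \<delta>..}"] intro!: \<Gamma>.integrable_in_unit)
  also have "(\<integral>m. 1 - q * indicator {1 - \<delta>..} m \<partial>\<Gamma>) = 1 - q * measure \<Gamma> {1 - \<delta>..}"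
    using set by (simp add: \<Gamma>.prob_space \<Gamma>.emeasure_eq_measure)
  also have "\<dots> \<le> 1 - q * (c0 * \<delta>)"
  proof -
    have "c0 * \<delta> \<le> measure \<Gamma> {1 - \<delta><..}" "measure \<Gamma> {1 - \<delta><..} \<le> measure \<Gamma> {1 - \<delta>..}"
      using regular assms by (auto simp: one_regular_def)
    then have "c0 * \<delta> \<le> measure \<Gamma> {1 - \<delta>..}" by linarith
    from mult_left_mono[OF this assms(3)] show ?thesis by linarith
  qed
  finally show ?thesis by (simp add: ennreal_leI)
qed

lemma emeasure_space_prior: "emeasure (prior_measure \<Gamma> k) (space (prior_measure \<Gamma> k)) = 1"
  unfolding prior_measure_def by (intro prob_space.emeasure_space_1 prob_space_PiM \<Gamma>)

lemma prior_component_measurable: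
  "(\<lambda>\<mu>. \<mu> i) \<in> borel_measurable (prior_measure \<Gamma> k)"
  unfolding prior_measure_def by (rule borel_measurable_PiM_component) (rule sets_\<Gamma>)

lemma nn_integral_prior_component:
  assumes "i < k" and [measurable]: "f \<in> borel_measurable borel"
  shows "(\<integral>\<^sup>+\<mu>. f (\<mu> i) \<partial>prior_measure \<Gamma> k) = (\<integral>\<^sup>+m. f m \<partial>\<Gamma>)"
proof -
  note [measurable_cong] = sets_\<Gamma>
  have "(\<integral>\<^sup>+m. f m \<partial>\<Gamma>) = (\<integral>\<^sup>+m. f m \<partial>distr (prior_measure \<Gamma> k) \<Gamma> (\<lambda>\<mu>. \<mu> i))"
    unfolding prior_measure_def using assms by (subst distr_PiM_component) (auto intro: \<Gamma>)
  also have "\<dots> = (\<integral>\<^sup>+\<mu>. f (\<mu> i) \<partial>prior_measure \<Gamma> k)"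
    unfolding prior_measure_def using assms by (subst nn_integral_distr) auto
  finally show ?thesis by simp
qed

lemma nn_integral_prior_prod:
  assumes "S \<subseteq> {..<k}" and [measurable]: "f \<in> borel_measurable borel"
  shows "(\<integral>\<^sup>+\<mu>. (\<Prod>i\<in>S. f (\<mu> i)) \<partial>prior_measure \<Gamma> k) = (\<integral>\<^sup>+m. f m \<partial>\<Gamma>) ^ card S"
proof -
  note [measurable_cong] = sets_\<Gamma>
  have prod_S: "(\<Prod>i\<in>S. g i) = (\<Prod>i<k. if i \<in> S then g i else 1)" for g :: "nat \<Rightarrow> ennreal"
    using assms(1) by (subst prod.inter_restrict[symmetric]) (auto simp: Int_absorb1)
  have "(\<integral>\<^sup>+\<mu>. (\<Prod>i\<in>S. f (\<mu> i)) \<partial>prior_measure \<Gamma> k)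
      = (\<integral>\<^sup>+\<mu>. (\<Prod>i<k. (\<lambda>i m. if i \<in> S then f m else 1) i (\<mu> i)) \<partial>prior_measure \<Gamma> k)"
    by (simp add: prod_S)
  also have "\<dots> = (\<Prod>i<k. \<integral>\<^sup>+m. (if i \<in> S then f m else 1) \<partial>\<Gamma>)"
    unfolding prior_measure_def by (rule prior.product_nn_integral_prod) auto
  also have "\<dots> = (\<Prod>i\<in>S. \<integral>\<^sup>+m. f m \<partial>\<Gamma>)"
    unfolding prod_S by (intro prod.cong) (auto simp: \<Gamma>.emeasure_space_1)
  finally show ?thesis by simp
qed

section \<open>Bayesian regret of Greedy on a list of arms\<close>

lemma conditional_regret_le:
  assumes as: "as \<noteq> []" "distinct as" "set as \<subseteq> {..<k}"
    and \<delta>: "0 < \<delta>" "\<delta> \<le> 1 / 20" "\<delta> \<le> \<delta>0"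
    and unit: "\<And>i. i < k \<Longrightarrow> \<mu> i \<in> {0..1}" and q: "q \<le> 1" "q = p0 * \<delta> / 2"
  shows "(\<integral>\<^sup>+w. ennreal (real T * (MAX i\<in>{..<k}. \<mu> i) - (\<Sum>t<T. \<mu> (greedy_policy as (curry w) t)))
      \<partial>reward_measure P k T \<mu>)
    \<le> ennreal (real T) * (\<Prod>i\<in>set as. ennreal (if 1 - \<delta> \<le> \<mu> i then 1 - q else 1))
      + ennreal (3 * \<delta> * real T) + (\<Sum>j\<in>set as. ennreal (gap_cost \<delta> (\<mu> j)))"
proof -
  have "greedy_run as k (\<lambda>i. P (\<mu> i))"
  proof (rule greedy_run.intro)
    show "prob_space (P (\<mu> i))" "sets (P (\<mu> i)) = sets borel" if "i < k" for i
      using P_prob[OF unit[OF that]] by simp_all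
  qed (fact as)+
  note run = greedy_run.nn_integral_regret_le[OF this, where T = T and \<mu> = \<mu> and \<delta> = \<delta> and q = q,
    unfolded greedy_run.rewards_def[OF this] greedy_run.arm_def[OF this]]
  show ?thesis
    unfolding reward_measure_def
  proof (rule run)
    show "\<exists>\<sigma>. survival_minorant (P (\<mu> i)) (1 - 2 * \<delta>) \<sigma> \<and> q \<le> \<sigma> 0" if "i < k" "1 - \<delta> \<le> \<mu> i" for i
      unfolding q(2) using unit[OF that(1)] \<delta> that(2) by (intro survival_minorant_exists) auto
    show "subgaussian1 (P (\<mu> i)) (\<mu> i)" if "i < k" for i
      using unit[OF that] by (rule P_sub)
    show "0 \<le> \<mu> i \<and> \<mu> i \<le> 1" if "i < k" for i
      using unit[OF that] by simp
  qed (fact \<delta> q)+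
qed

lemma bayes_regret_greedy_le:
  assumes as: "as \<noteq> []" "distinct as" "set as \<subseteq> {..<k}"
    and \<delta>: "0 < \<delta>" "\<delta> \<le> 1 / 20" "\<delta> \<le> \<delta>0"
  shows "bayes_regret \<Gamma> P k T (greedy_policy as)
    \<le> ennreal (real T * (1 - p0 * c0 * \<delta>\<^sup>2 / 2) ^ length as + 3 * \<delta> * real T
        + real (length as) * (3 * C0 / ((1 - exp (-1)) / 2) * (3 - ln \<delta>)))"
proof -
  define q where "q = p0 * \<delta> / 2"
  have q: "0 \<le> q" "q \<le> 1" using \<delta> p0 survival_le_one[OF \<delta>] by (auto simp: q_def)
  define K where "K = 3 * C0 / ((1 - exp (-1)) / 2) * (3 - ln \<delta>)"
  have "ln \<delta> \<le> 0" using \<delta> by simp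
  then have K: "0 \<le> K"
    using C0_nonneg exp_minus_one_bounds by (simp add: K_def)
  define fac where "fac m = ennreal (if 1 - \<delta> \<le> m then 1 - q else 1)" for m
  have fac [measurable]: "fac \<in> borel_measurable borel" unfolding fac_def by measurable
  have [measurable]: "(\<lambda>\<mu>. fac (\<mu> i)) \<in> borel_measurable (prior_measure \<Gamma> k)"
    "(\<lambda>\<mu>. gap_cost \<delta> (\<mu> i)) \<in> borel_measurable (prior_measure \<Gamma> k)" for i
    by (rule measurable_compose[OF prior_component_measurable], measurable)+
  define B where "B \<mu> = ennreal (real T) * (\<Prod>i\<in>set as. fac (\<mu> i))
      + ennreal (3 * \<delta> * real T) + (\<Sum>j\<in>set as. ennreal (gap_cost \<delta> (\<mu> j)))" for \<mu> :: "nat \<Rightarrow> real"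
  \<comment> \<open>\<open>B\<close> is inserted before linearity is used, being measurable in the
    means. The comparison holds almost surely, namely when all means lie in the unit
    interval.\<close>
  have "bayes_regret \<Gamma> P k T (greedy_policy as) \<le> (\<integral>\<^sup>+\<mu>. B \<mu> \<partial>prior_measure \<Gamma> k)"
    unfolding bayes_regret_def
  proof (rule nn_integral_mono_AE)
    have "AE m in \<Gamma>. m \<in> {0..1}"
      using supp by (subst \<Gamma>.AE_in_set_eq_1) (auto simp: sets_\<Gamma> measure_def)
    then have "AE \<mu> in prior_measure \<Gamma> k. \<forall>i\<in>{..<k}. \<mu> i \<in> {0..1}"
      unfolding prior_measure_def by (intro AE_finite_allI AE_PiM_component \<Gamma>) auto
    then show "AE \<mu> in prior_measure \<Gamma> k.
        (\<integral>\<^sup>+w. ennreal (real T * (MAX i\<in>{..<k}. \<mu> i) - (\<Sum>t<T. \<mu> (greedy_policy as (curry w) t)))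
          \<partial>reward_measure P k T \<mu>) \<le> B \<mu>"
    proof eventually_elim
      case (elim \<mu>)
      then have unit: "\<mu> i \<in> {0..1}" if "i < k" for i using that by blast
      show ?case
        unfolding B_def fac_def by (rule conditional_regret_le[OF as \<delta> unit q(2)]) (simp_all add: q_def)
    qed
  qed
  also have "\<dots> = ennreal (real T) * (\<integral>\<^sup>+\<mu>. (\<Prod>i\<in>set as. fac (\<mu> i)) \<partial>prior_measure \<Gamma> k)
      + ennreal (3 * \<delta> * real T)
      + (\<Sum>j\<in>set as. \<integral>\<^sup>+\<mu>. ennreal (gap_cost \<delta> (\<mu> j)) \<partial>prior_measure \<Gamma> k)"
    unfolding B_def
    by (simp add: nn_integral_add nn_integral_sum nn_integral_cmult emeasure_space_prior)
  also have "(\<integral>\<^sup>+\<mu>. (\<Prod>i\<in>set as. fac (\<mu> i)) \<partial>prior_measure \<Gamma> k) = (\<integral>\<^sup>+m. fac m \<partial>\<Gamma>) ^ length as"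
    using as by (simp add: nn_integral_prior_prod distinct_card)
  also have "(\<Sum>j\<in>set as. \<integral>\<^sup>+\<mu>. ennreal (gap_cost \<delta> (\<mu> j)) \<partial>prior_measure \<Gamma> k)
      = of_nat (length as) * (\<integral>\<^sup>+m. ennreal (gap_cost \<delta> m) \<partial>\<Gamma>)"
  proof -
    have "(\<Sum>j\<in>set as. \<integral>\<^sup>+\<mu>. ennreal (gap_cost \<delta> (\<mu> j)) \<partial>prior_measure \<Gamma> k)
        = (\<Sum>j\<in>set as. \<integral>\<^sup>+m. ennreal (gap_cost \<delta> m) \<partial>\<Gamma>)"
      using as by (intro sum.cong nn_integral_prior_component) auto
    then show ?thesis using as by (simp add: distinct_card)
  qed
  also have "ennreal (real T) * (\<integral>\<^sup>+m. fac m \<partial>\<Gamma>) ^ length as + ennreal (3 * \<delta> * real T)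
        + of_nat (length as) * (\<integral>\<^sup>+m. ennreal (gap_cost \<delta> m) \<partial>\<Gamma>)
      \<le> ennreal (real T) * ennreal (1 - q * (c0 * \<delta>)) ^ length as + ennreal (3 * \<delta> * real T)
        + of_nat (length as) * ennreal K"
    unfolding fac_def K_def using \<delta> q
    by (intro add_mono mult_left_mono power_mono order_refl nn_integral_survival_factor_le
          nn_integral_gap_cost_le[OF \<Gamma> sets_\<Gamma> supp regular]) auto
  also have "\<dots> = ennreal (real T * (1 - q * (c0 * \<delta>)) ^ length as + 3 * \<delta> * real T + real (length as) * K)"
  proof -
    have "q * (c0 * \<delta>) \<le> 1 * (1 * 1)" using q c0 c0_le_one \<delta> by (intro mult_mono) auto
    then show ?thesis using \<delta> K by (simp add: ennreal_mult ennreal_power ennreal_of_nat_eq_real_of_nat)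
  qed
  also have "q * (c0 * \<delta>) = p0 * c0 * \<delta>\<^sup>2 / 2" by (simp add: q_def power2_eq_square)
  finally show ?thesis by (simp add: K_def)
qed

text \<open>Only the number \<open>m\<close> of arms open to Greedy enters, so one bound serves both
  full Greedy and every subsample.\<close>

lemma bayes_regret_greedy_bound:
  assumes as: "distinct as" "set as \<subseteq> {..<k}" and m: "length as = m" and T: "2 \<le> T"
    and large: "real m \<ge> 4 * exp 1 * ln (real T) * max 400 (1 / \<delta>0\<^sup>2) / (c0 * p0)" and \<delta>0: "0 < \<delta>0"
  shows "bayes_regret \<Gamma> P k T (greedy_policy as)
    \<le> ennreal (1 + 3 * real T * sqrt (4 * exp 1 * ln (real T) / (real m * c0 * p0))
        + 3 * C0 * real m / (2 * ((1 - exp (-1)) / 2))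
          * (10 + ln (real m * c0 * p0 / (4 * exp 1)) - ln (ln (real T))))"
proof -
  define C where "C = (1 - exp (-1 :: real)) / 2"
  have C: "0 < C" using exp_minus_one_bounds by (simp add: C_def)
  have lnT: "0 < ln (real T)" using T by simp
  define a where "a = 4 * exp 1 * ln (real T)"
  have a: "0 < a" using lnT by (simp add: a_def)
  define M where "M = max 400 (1 / \<delta>0\<^sup>2)"
  have M: "400 \<le> M" "1 / \<delta>0\<^sup>2 \<le> M" by (auto simp: M_def)
  have cp: "0 < c0 * p0" using c0 p0 by simp
  have large': "a * M / (c0 * p0) \<le> real m" using large by (simp add: a_def M_def)
  have "0 < a * M / (c0 * p0)" using a M cp by simp
  with large' have m_pos: "0 < real m" by linarith
  \<comment> \<open>This choice gives m p0 c0 \<delta>^2 / 2 = 2 e ln T, enough to push the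
    probability that no good arm survives below 1/T. The assumed size of \<open>m\<close> says
    \<delta>^2 \<le> 1/M, that is, \<delta> \<le> 1/20 and \<delta> \<le> \<delta>0.\<close>
  define \<delta> where "\<delta> = sqrt (a / (real m * c0 * p0))"
  have \<delta>2: "\<delta>\<^sup>2 = a / (real m * c0 * p0)" using a m_pos c0 p0 by (simp add: \<delta>_def)
  have \<delta>_pos: "0 < \<delta>" using a m_pos c0 p0 by (simp add: \<delta>_def)
  have "\<delta>\<^sup>2 \<le> 1 / M"
    using large' a M cp m_pos c0 p0 by (simp add: \<delta>2 field_simps)
  have "\<delta>\<^sup>2 \<le> (1 / 20)\<^sup>2"
  proof -
    have "1 / M \<le> 1 / 400" using M by (intro divide_left_mono) auto
    then show ?thesis using \<open>\<delta>\<^sup>2 \<le> 1 / M\<close> by (simp add: power_divide)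
  qed
  then have \<delta>1: "\<delta> \<le> 1 / 20" by (rule power2_le_imp_le) simp
  have "1 / M \<le> \<delta>0\<^sup>2" using M \<delta>0 by (simp add: field_simps)
  then have "\<delta>\<^sup>2 \<le> \<delta>0\<^sup>2" using \<open>\<delta>\<^sup>2 \<le> 1 / M\<close> by linarith
  then have \<delta>2': "\<delta> \<le> \<delta>0" by (rule power2_le_imp_le) (use \<delta>0 in simp)
  have "as \<noteq> []" using m m_pos by auto
  have "bayes_regret \<Gamma> P k T (greedy_policy as)
    \<le> ennreal (real T * (1 - p0 * c0 * \<delta>\<^sup>2 / 2) ^ m + 3 * \<delta> * real T
        + real m * (3 * C0 / C * (3 - ln \<delta>)))"
    using bayes_regret_greedy_le[OF \<open>as \<noteq> []\<close> as \<delta>_pos \<delta>1 \<delta>2', of T] by (simp add: m C_def)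
  also have "\<dots> \<le> ennreal (1 + 3 * real T * \<delta> + 3 * C0 * real m / (2 * C) *
      (10 + ln (real m * c0 * p0 / (4 * exp 1)) - ln (ln (real T))))"
  proof (intro ennreal_leI add_mono)
    define x where "x = p0 * c0 * \<delta>\<^sup>2 / 2"
    have "x * real m = 2 * exp 1 * ln (real T)"
      using m_pos c0 p0 by (simp add: x_def \<delta>2 a_def)
    then have xm: "ln (real T) \<le> x * real m"
      using lnT mult_right_mono[of 1 "2 * exp 1" "ln (real T)"] exp_ge_add_one_self[of "1 :: real"] by simp
    have "x = p0 * \<delta> / 2 * (c0 * \<delta>)" by (simp add: x_def power2_eq_square)
    also have "\<dots> \<le> 1 * (1 * 1)"
      using survival_le_one[OF \<delta>_pos \<delta>1 \<delta>2'] c0 c0_le_one \<delta>_pos \<delta>1 by (intro mult_mono) auto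
    finally have "(1 - x) ^ m \<le> exp (- x) ^ m"
      using exp_ge_add_one_self[of "- x"] by (intro power_mono) auto
    also have "\<dots> = exp (- (x * real m))" by (simp add: exp_of_nat_mult[symmetric] mult.commute)
    also have "\<dots> \<le> exp (- ln (real T))" using xm by simp
    also have "\<dots> = 1 / real T" using T by (simp add: exp_minus field_simps)
    finally show "real T * (1 - p0 * c0 * \<delta>\<^sup>2 / 2) ^ m \<le> 1"
      using T by (simp add: x_def field_simps)
    have "ln (\<delta>\<^sup>2) = ln (ln (real T) / (real m * c0 * p0 / (4 * exp 1)))"
      by (simp add: \<delta>2 a_def mult.commute)
    also have "\<dots> = ln (ln (real T)) - ln (real m * c0 * p0 / (4 * exp 1))"
      using lnT m_pos c0 p0 by (subst ln_div) auto
    \<comment> \<open>The term - 2 ln \<delta> is exactly the two logarithms; 6 comes from doubling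
      \<open>3 - ln \<delta>\<close> and leaves slack below 10.\<close>
    finally have "6 - 2 * ln \<delta> \<le> 10 + ln (real m * c0 * p0 / (4 * exp 1)) - ln (ln (real T))"
      using \<delta>_pos by (simp add: ln_realpow)
    then have "3 * C0 * real m / (2 * C) * (6 - 2 * ln \<delta>) \<le> 3 * C0 * real m / (2 * C) *
        (10 + ln (real m * c0 * p0 / (4 * exp 1)) - ln (ln (real T)))"
      using C C0_nonneg by (intro mult_left_mono) auto
    then show "real m * (3 * C0 / C * (3 - ln \<delta>)) \<le> 3 * C0 * real m / (2 * C) *
      (10 + ln (real m * c0 * p0 / (4 * exp 1)) - ln (ln (real T)))"
      using C by (simp add: field_simps)
  qed simp
  finally show ?thesis by (simp add: \<delta>_def a_def C_def)
qed

section \<open>SS-Greedy\<close>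

lemma ss_greedy_bayes_regret_le:
  assumes bound: "\<And>as. distinct as \<Longrightarrow> set as \<subseteq> {..<k} \<Longrightarrow> length as = m \<Longrightarrow>
      bayes_regret \<Gamma> P k T (greedy_policy as) \<le> B"
    and "m \<le> k"
  shows "ss_greedy_bayes_regret \<Gamma> P k T m \<le> B"
proof -
  let ?A = "{S. S \<subseteq> {..<k} \<and> card S = m}"
  have fin: "finite ?A" by (rule finite_subset[of _ "Pow {..<k}"]) auto
  have "{..<m} \<in> ?A" using \<open>m \<le> k\<close> by auto
  then have ne: "?A \<noteq> {}" by blast
  have "ss_greedy_bayes_regret \<Gamma> P k T m \<le> (\<integral>\<^sup>+S. B \<partial>measure_pmf (pmf_of_set ?A))"
    unfolding ss_greedy_bayes_regret_def
  proof (intro nn_integral_mono_AE, unfold AE_measure_pmf_iff set_pmf_of_set[OF ne fin], intro ballI)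
    fix S assume "S \<in> ?A"
    then have "finite S" "S \<subseteq> {..<k}" "card S = m" by (auto intro: finite_subset)
    then show "bayes_regret \<Gamma> P k T (greedy_policy (sorted_list_of_set S)) \<le> B"
      by (intro bound) auto
  qed
  also have "\<dots> = B" by simp
  finally show ?thesis .
qed

text \<open>For \<open>m\<close> of order T^(2/3) both T sqrt(ln T / m) and m ln T are of order
  T^(2/3) up to logarithms, and a single factor ln T covers both.\<close>

lemma ss_greedy_rate:
  assumes m: "(\<lambda>T. real (m T)) \<in> \<Theta>(\<lambda>T. real T powr (2/3))" and \<delta>0: "0 < \<delta>0"
  shows "\<exists>C. \<forall>\<^sub>F T in sequentially. \<forall>k \<ge> m T.
    ss_greedy_bayes_regret \<Gamma> P k T (m T) \<le> ennreal (C * real T powr (2/3) * ln (real T) ^ 1)"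
proof -
  obtain c1 where c1: "0 < c1" and lower: "\<forall>\<^sub>F T in sequentially. c1 * real T powr (2/3) \<le> real (m T)"
    using landau_omega.bigE[OF bigthetaD2[OF m]] by (auto elim!: eventually_mono)
  obtain c2 where c2: "0 < c2" and upper: "\<forall>\<^sub>F T in sequentially. real (m T) \<le> c2 * real T powr (2/3)"
    using landau_o.bigE[OF bigthetaD1[OF m]] by auto
  define M where "M = max 400 (1 / \<delta>0\<^sup>2)"
  define K where "K = 4 * exp 1 * M / (c0 * p0)"
  define A where "A = 4 * exp 1 / (c1 * c0 * p0)"
  define L where "L = 3 * C0 / (2 * ((1 - exp (-1)) / 2))"
  define D where "D = c2 * c0 * p0 / (4 * exp 1)"
  define C where "C = 1 + 3 * sqrt A + L * c2 * (11 + \<bar>ln D\<bar>)"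
  have A: "0 < A" and D: "0 < D" using c0 p0 c1 c2 by (auto simp: A_def D_def)
  have L: "0 \<le> L" using C0_nonneg exp_minus_one_bounds by (simp add: L_def)
  \<comment> \<open>The number of arms required by the Greedy bound is only logarithmic in
    \<open>T\<close>, so \<open>m T\<close> eventually exceeds it.\<close>
  have "\<forall>\<^sub>F T in sequentially. K * ln (real T) \<le> c1 * real T powr (2/3)"
    using c1 by real_asymp
  moreover have "\<forall>\<^sub>F T in sequentially. 1 \<le> ln (real T)" by real_asymp
  ultimately have "\<forall>\<^sub>F T in sequentially. \<forall>k \<ge> m T.
    ss_greedy_bayes_regret \<Gamma> P k T (m T) \<le> ennreal (C * real T powr (2/3) * ln (real T) ^ 1)"
    using lower upper eventually_ge_at_top[of 2]
  proof eventually_elim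
    case (elim T)
    define l where "l = ln (real T)"
    define R where "R = real T powr (2/3)"
    define b where "b = 1 + 3 * real T * sqrt (4 * exp 1 * l / (real (m T) * c0 * p0))
        + L * real (m T) * (10 + ln (real (m T) * c0 * p0 / (4 * exp 1)) - ln l)"
    have l: "1 \<le> l" and T: "2 \<le> T" and mT: "c1 * R \<le> real (m T)" "real (m T) \<le> c2 * R"
      using elim by (auto simp: l_def R_def)
    have R: "1 \<le> R" using T by (simp add: R_def ge_one_powr_ge_zero)
    have m_pos: "0 < real (m T)" using mT c1 R by (smt (verit) mult_pos_pos)
    have bound: "ss_greedy_bayes_regret \<Gamma> P k T (m T) \<le> ennreal b" if "m T \<le> k" for k
    proof (rule ss_greedy_bayes_regret_le[OF _ that])
      fix as assume as: "distinct as" "set as \<subseteq> {..<k}" "length as = m T"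
      have "4 * exp 1 * ln (real T) * max 400 (1 / \<delta>0\<^sup>2) / (c0 * p0) = K * ln (real T)"
        by (simp add: K_def M_def)
      also have "\<dots> \<le> real (m T)" using elim by linarith
      finally have "bayes_regret \<Gamma> P k T (greedy_policy as) \<le> ennreal
        (1 + 3 * real T * sqrt (4 * exp 1 * ln (real T) / (real (m T) * c0 * p0))
          + 3 * C0 * real (m T) / (2 * ((1 - exp (-1)) / 2))
            * (10 + ln (real (m T) * c0 * p0 / (4 * exp 1)) - ln (ln (real T))))"
        by (rule bayes_regret_greedy_bound[OF as T _ \<delta>0])
      then show "bayes_regret \<Gamma> P k T (greedy_policy as) \<le> ennreal b"
        unfolding b_def l_def L_def times_divide_eq_left .
    qed
    have sqrt_term: "real T * sqrt (4 * exp 1 * l / (real (m T) * c0 * p0)) \<le> sqrt A * (R * l)"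
    proof -
      have "4 * exp 1 * l / (real (m T) * c0 * p0) \<le> 4 * exp 1 * l / (c1 * R * c0 * p0)"
        using l mT c0 p0 c1 R m_pos by (intro divide_left_mono mult_right_mono mult_pos_pos) auto
      also have "\<dots> = A * (l / R)" by (simp add: A_def)
      \<comment> \<open>Raising \<open>l\<close> to its square lets the root produce a full factor
        \<open>l\<close>, matching the other term.\<close>
      also have "\<dots> \<le> A * (l\<^sup>2 / R)"
        using A l R by (intro mult_left_mono divide_right_mono) (auto simp: power2_eq_square)
      finally have "sqrt (4 * exp 1 * l / (real (m T) * c0 * p0)) \<le> sqrt (A * (l\<^sup>2 / R))"
        by (rule real_sqrt_le_mono)
      also have "\<dots> = sqrt A * (l / sqrt R)"
        using l by (simp add: real_sqrt_mult real_sqrt_divide)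
      also have "sqrt R = real T powr (1/3)"
        by (simp add: R_def powr_half_sqrt[symmetric] powr_powr)
      finally have "real T * sqrt (4 * exp 1 * l / (real (m T) * c0 * p0))
          \<le> real T * (sqrt A * (l / real T powr (1/3)))" by (rule mult_left_mono) simp
      also have "real T * (sqrt A * (l / real T powr (1/3))) = sqrt A * (real T / real T powr (1/3) * l)"
        by simp
      also have "real T / real T powr (1/3) = R"
        using T powr_diff[of "real T" 1 "1/3"] by (simp add: R_def)
      finally show ?thesis .
    qed
    have log_term: "L * real (m T) * (10 + ln (real (m T) * c0 * p0 / (4 * exp 1)) - ln l)
        \<le> L * c2 * (11 + \<bar>ln D\<bar>) * (R * l)"
    proof -
      have "real (m T) * c0 * p0 / (4 * exp 1) \<le> D * R"
        using mT(2) c0 p0 by (simp add: D_def divide_right_mono mult_right_mono)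
      then have "ln (real (m T) * c0 * p0 / (4 * exp 1)) \<le> ln (D * R)"
        using m_pos c0 p0 D R by (subst ln_le_cancel_iff) auto
      also have "\<dots> = ln D + 2 / 3 * l"
        using D R T by (simp add: ln_mult R_def l_def ln_powr)
      finally have "10 + ln (real (m T) * c0 * p0 / (4 * exp 1)) - ln l \<le> 10 + \<bar>ln D\<bar> + l"
        using l ln_ge_zero[OF l] by linarith
      also have "\<dots> \<le> (11 + \<bar>ln D\<bar>) * l"
        using l mult_left_mono[OF l, of "10 + \<bar>ln D\<bar>"] by (simp add: algebra_simps)
      finally have le: "10 + ln (real (m T) * c0 * p0 / (4 * exp 1)) - ln l \<le> (11 + \<bar>ln D\<bar>) * l" .
      have "L * real (m T) * (10 + ln (real (m T) * c0 * p0 / (4 * exp 1)) - ln l)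
          \<le> L * real (m T) * ((11 + \<bar>ln D\<bar>) * l)"
        using L by (intro mult_left_mono le) auto
      also have "\<dots> \<le> L * (c2 * R) * ((11 + \<bar>ln D\<bar>) * l)"
        using L l mT(2) by (intro mult_right_mono mult_left_mono) auto
      finally show ?thesis by (simp add: ac_simps)
    qed
    \<comment> \<open>This absorbs the additive 1 of \<open>b\<close> into the summand 1 of
      \<open>C\<close>.\<close>
    have "1 * 1 \<le> R * l" using R l by (intro mult_mono) auto
    then have "b \<le> C * R * l"
      using sqrt_term log_term by (simp add: b_def C_def algebra_simps)
    then show ?case
      using bound order_trans[OF bound ennreal_leI] by (simp add: R_def l_def)
  qed
  then show ?thesis by blast
qed

end

theorem theorem5:
  fixes \<Gamma> :: "real measure" and P :: "real \<Rightarrow> real measure"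
    and c0 C0 p0 \<delta>0 :: real
  assumes prior_prob: "prob_space \<Gamma>"
    and prior_density: "\<exists>g. g \<in> borel_measurable borel \<and> \<Gamma> = density lborel g"
    and prior_support: "emeasure \<Gamma> {0..1} = 1"
    and constants: "0 < c0" "c0 < C0"
    and regular: "one_regular \<Gamma> c0 C0"
    and family_prob: "\<And>\<mu>. \<mu> \<in> {0..1} \<Longrightarrow> prob_space (P \<mu>) \<and> sets (P \<mu>) = sets borel"
    and family_mean: "\<And>\<mu>. \<mu> \<in> {0..1} \<Longrightarrow> has_mean (P \<mu>) \<mu>"
    and family_subg: "\<And>\<mu>. \<mu> \<in> {0..1} \<Longrightarrow> subgaussian1 (P \<mu>) \<mu>"
    and params: "0 < p0" "0 < \<delta>0"
    and upward: "uniformly_upward_looking P p0 \<delta>0"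
  shows
    "(\<forall>T k. T \<ge> 2 \<and>
        real k \<ge> 4 * exp 1 * ln (real T) * max 400 (1 / \<delta>0\<^sup>2) / (c0 * p0) \<longrightarrow>
        greedy_bayes_regret \<Gamma> P k T
          \<le> ennreal (1 + 3 * real T * sqrt (4 * exp 1 * ln (real T) / (real k * c0 * p0))
                     + 3 * C0 * real k / (2 * ((1 - exp (-1)) / 2))
                       * (10 + ln (real k * c0 * p0 / (4 * exp 1)) - ln (ln (real T)))))
     \<and>
     (\<forall>m :: nat \<Rightarrow> nat. (\<lambda>T. real (m T)) \<in> \<Theta>(\<lambda>T. real T powr (2/3)) \<longrightarrow>
        (\<exists>C (a::nat). \<forall>\<^sub>F T in sequentially. \<forall>k \<ge> m T.
            ss_greedy_bayes_regret \<Gamma> P k T (m T) \<le> ennreal (C * real T powr (2/3) * ln (real T) ^ a)))"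
proof -
  interpret bandit \<Gamma> P c0 C0 p0 \<delta>0
  proof (rule bandit.intro)
    show "sets \<Gamma> = sets borel" using prior_density by auto
  qed (fact assms)+
  show ?thesis
  proof (intro conjI allI impI, elim conjE)
    fix T k :: nat
    assume "2 \<le> T" "4 * exp 1 * ln (real T) * max 400 (1 / \<delta>0\<^sup>2) / (c0 * p0) \<le> real k"
    then show "greedy_bayes_regret \<Gamma> P k T
          \<le> ennreal (1 + 3 * real T * sqrt (4 * exp 1 * ln (real T) / (real k * c0 * p0))
                     + 3 * C0 * real k / (2 * ((1 - exp (-1)) / 2))
                       * (10 + ln (real k * c0 * p0 / (4 * exp 1)) - ln (ln (real T))))"
      \<comment> \<open>Greedy on all arms is the list \<open>[0..<k]\<close>, with \<open>k\<close>
        in place of \<open>m\<close>.\<close>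
      unfolding greedy_bayes_regret_def by (intro bayes_regret_greedy_bound params(2)) auto
  next
    fix m :: "nat \<Rightarrow> nat"
    assume "(\<lambda>T. real (m T)) \<in> \<Theta>(\<lambda>T. real T powr (2/3))"
    from ss_greedy_rate[OF this params(2)]
    show "\<exists>C (a::nat). \<forall>\<^sub>F T in sequentially. \<forall>k \<ge> m T.
            ss_greedy_bayes_regret \<Gamma> P k T (m T) \<le> ennreal (C * real T powr (2/3) * ln (real T) ^ a)"
      by blast
  qed
qed

end
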